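(* Let $(X,f)$ be a minimal zero-dimensional system whose topological rank is $K$, where $1<K<\infty$. Then its natural extension $(\hat X_f,\sigma)$ is expansive.
   Context: Systems. A zero-dimensional system is a pair $(X,f)$ with $X$ a compact zero-dimensional metrizable space and $f:X\to X$ a continuous surjection (not necessarily injective). It is minimal if every forward orbit is dense. The natural extension of $(X,f)$ is $(\hat X_f,\sigma)$, where $\hat X_f=\{(x_i)_{i\in\mathbb Z}\in X^{\mathbb Z} : f(x_i)=x_{i+1}\text{ for all }i\in\mathbb Z\}$ with the product topology and $(\sigma(\hat x))_i=x_{i+1}$. A homeomorphism $T$ of a compact metrizable space (with compatible metric $d$) is expansive if there is $\varepsilon>0$ such that for all $x\ne y$ there is $i\in\mathbb Z$ with $d(T^ix,T^iy)>\varepsilon$; for a zero-dimensional space this means being topologically conjugate to a two-sided subshift over a finite alphabet. Graphs. A graph $G=(V,E)$ is a finite directed graph with $E\subseteq V\times V$ (no multiple edges) such that every vertex has at least one incoming and at least one outgoing edge. A graph homomorphism $\varphi:G_1\to G_2$ is a map $V_1\to V_2$ with $(\varphi(u),\varphi(v))\in E_2$ for all $(u,v)\in E_1$; it is edge-surjective if $\varphi(E_1)=E_2$, and $+$directional if $(u,v),(u,v')\in E_1$ implies $\varphi(v)=\varphi(v')$. A cover is a $+$directional edge-surjective graph homomorphism. A covering is a sequence of covers $G_0\xleftarrow{\varphi_0}G_1\xleftarrow{\varphi_1}G_2\xleftarrow{\varphi_2}\cdots$ with $\varphi_n:G_{n+1}\to G_n$, where $G_0=(\{v_0\},\{(v_0,v_0)\})$.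 Put $\varphi_{m,n}=\varphi_n\circ\cdots\circ\varphi_{m-1}$ for $m>n$. Its inverse limit is the zero-dimensional system $G_\infty$ with space $V_{\mathcal G}=\{(x_i)_{i\ge0}\in\prod_i V_i: x_i=\varphi_i(x_{i+1})\text{ for all }i\}$ (product topology), and with map whose graph is $E_{\mathcal G}=\{(x,y)\in V_{\mathcal G}\times V_{\mathcal G}:(x_i,y_i)\in E_i\text{ for all }i\}$ (this is the graph of a continuous surjection). A circuit of period $l\ge1$ in $G$ is a walk $c=(v_0,v_1,\dots,v_l)$ along edges with $v_0=v_l$ and $v_0,\dots,v_{l-1}$ distinct. For a walk $w$, $E(w)$ denotes its set of edges; $E(G)$ is the edge set of $G$. GM-coverings. A covering is of Gambaudo--Martens type (a GM-covering) if for each $n>0$ there are a vertex $v_{n,0}$ of $G_n$ and finitely many pairwise distinct circuits $c_{n,i}$ $(1\le i\le l_n)$ such that: (a) $c_{n,i}=(v_{n,0}=v_{n,i,0},v_{n,i,1},\dots,v_{n,i,l(n,i)}=v_{n,0})$ with $l(n,i)\ge1$; (b) $\bigcup_{i=1}^{l_n}E(c_{n,i})=E(G_n)$; (c) if $v_{n,i,j}=v_{n,i',j'}$ with $j,j'\ge1$, then $v_{n,i,j+k}=v_{n,i',j'+k}$ for $k=0,1,2,\dots$ until $j+k=l(n,i)$ and $j'+k=l(n,i')$ at the same time; (d) $\varphi_n(v_{n+1,0})=v_{n,0}$; (e) $\varphi_n(v_{n+1,i,1})=v_{n,1,1}$ for all $1\le i\le l_{n+1}$. It is simple if for all $n>0$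 there is $m>n$ such that $E(\varphi_{m,n}(c_{m,i}))=E(G_n)$ for each $1\le i\le l_m$. Its rank is $\liminf_{n\to\infty}l_n\in[1,\infty]$. Topological rank. A minimal zero-dimensional system has topological rank $K$ if it is topologically conjugate to the inverse limit of a simple GM-covering of rank $K$ and $K$ is the smallest such value. *)

theory Defs
  imports
    "HOL-Analysis.Analysis"
    "HOL-Library.Extended_Nat"
    "HOL-Library.Liminf_Limsup"
    "Graph_Theory.Pair_Digraph"
    "Graph_Theory.Vertex_Walk"
begin

section \<open>Zero-dimensional systems\<close>

definition zero_dim_system :: "'a topology \<Rightarrow> ('a \<Rightarrow> 'a) \<Rightarrow> bool" where
  "zero_dim_system X f \<longleftrightarrow>
     compact_space X \<and> metrizable_space X \<and> X dim_le 0 \<and>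
     continuous_map X X f \<and> f ` topspace X = topspace X"

definition minimal :: "'a topology \<Rightarrow> ('a \<Rightarrow> 'a) \<Rightarrow> bool" where
  "minimal X f \<longleftrightarrow>
     (\<forall>x \<in> topspace X. X closure_of (range (\<lambda>n. (f ^^ n) x)) = topspace X)"

definition conjugate ::
    "'a topology \<Rightarrow> ('a \<Rightarrow> 'a) \<Rightarrow> 'b topology \<Rightarrow> ('b \<Rightarrow> 'b) \<Rightarrow> bool" where
  "conjugate X f Y g \<longleftrightarrow>
     (\<exists>h. homeomorphic_map X Y h \<and> (\<forall>x \<in> topspace X. h (f x) = g (h x)))"

definition natural_extension :: "'a topology \<Rightarrow> ('a \<Rightarrow> 'a) \<Rightarrow> (int \<Rightarrow> 'a) topology" where
  "natural_extension X f =
     subtopology (product_topology (\<lambda>_. X) UNIV) {x. \<forall>i. f (x i) = x (i + 1)}"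

definition shift :: "(int \<Rightarrow> 'a) \<Rightarrow> (int \<Rightarrow> 'a)" where
  "shift x = (\<lambda>i. x (i + 1))"

text \<open>Integer iterates of a bijection of \<^term>\<open>topspace X\<close>.\<close>

definition int_iterate :: "'a topology \<Rightarrow> ('a \<Rightarrow> 'a) \<Rightarrow> int \<Rightarrow> 'a \<Rightarrow> 'a" where
  "int_iterate X T i =
     (if 0 \<le> i then T ^^ nat i else inv_into (topspace X) T ^^ nat (- i))"

text \<open>On a compact space any two compatible metrics are uniformly equivalent, so the
  existential quantifier over the metric could equally be a universal one.\<close>

definition expansive :: "'a topology \<Rightarrow> ('a \<Rightarrow> 'a) \<Rightarrow> bool" where
  "expansive X T \<longleftrightarrow>
     compact_space X \<and> homeomorphic_map X X T \<and>
     (\<exists>d. Metric_space (topspace X) d \<and> Metric_space.mtopology (topspace X) d = X \<and>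
       (\<exists>\<epsilon>>0. \<forall>x \<in> topspace X. \<forall>y \<in> topspace X. x \<noteq> y \<longrightarrow>
         (\<exists>i. d (int_iterate X T i x) (int_iterate X T i y) > \<epsilon>)))"

section \<open>Graphs and coverings\<close>

definition covering_graph :: "'v pair_pre_digraph \<Rightarrow> bool" where
  "covering_graph G \<longleftrightarrow> pair_fin_digraph G \<and>
     (\<forall>v \<in> pverts G. (\<exists>u. (u, v) \<in> parcs G) \<and> (\<exists>w. (v, w) \<in> parcs G))"

definition graph_hom ::
    "'v pair_pre_digraph \<Rightarrow> 'w pair_pre_digraph \<Rightarrow> ('v \<Rightarrow> 'w) \<Rightarrow> bool" where
  "graph_hom G H \<phi> \<longleftrightarrow>
     \<phi> ` pverts G \<subseteq> pverts H \<and> (\<forall>(u, v) \<in> parcs G. (\<phi> u, \<phi> v) \<in> parcs H)"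

definition edge_surjective ::
    "'v pair_pre_digraph \<Rightarrow> 'w pair_pre_digraph \<Rightarrow> ('v \<Rightarrow> 'w) \<Rightarrow> bool" where
  "edge_surjective G H \<phi> \<longleftrightarrow> map_prod \<phi> \<phi> ` parcs G = parcs H"

definition plus_directional :: "'v pair_pre_digraph \<Rightarrow> ('v \<Rightarrow> 'w) \<Rightarrow> bool" where
  "plus_directional G \<phi> \<longleftrightarrow>
     (\<forall>u v v'. (u, v) \<in> parcs G \<longrightarrow> (u, v') \<in> parcs G \<longrightarrow> \<phi> v = \<phi> v')"

definition graph_cover ::
    "'v pair_pre_digraph \<Rightarrow> 'w pair_pre_digraph \<Rightarrow> ('v \<Rightarrow> 'w) \<Rightarrow> bool" where
  "graph_cover G H \<phi> \<longleftrightarrow> graph_hom G H \<phi> \<and> edge_surjective G H \<phi> \<and> plus_directional G \<phi>"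

definition covering :: "(nat \<Rightarrow> 'v pair_pre_digraph) \<Rightarrow> (nat \<Rightarrow> 'v \<Rightarrow> 'v) \<Rightarrow> bool" where
  "covering G \<phi> \<longleftrightarrow>
     (\<exists>v. G 0 = \<lparr> pverts = {v}, parcs = {(v, v)} \<rparr>) \<and>
     (\<forall>n. covering_graph (G n)) \<and>
     (\<forall>n. graph_cover (G (Suc n)) (G n) (\<phi> n))"

text \<open>\<open>cover_comp \<phi> m n = \<phi> n \<circ> \<dots> \<circ> \<phi> (m - 1)\<close> for \<open>m > n\<close>.\<close>

primrec cover_comp :: "(nat \<Rightarrow> 'v \<Rightarrow> 'v) \<Rightarrow> nat \<Rightarrow> nat \<Rightarrow> 'v \<Rightarrow> 'v" where
  "cover_comp \<phi> 0 n = id"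
| "cover_comp \<phi> (Suc m) n = (if n \<le> m then cover_comp \<phi> m n \<circ> \<phi> m else id)"

definition inverse_limit ::
    "(nat \<Rightarrow> 'v pair_pre_digraph) \<Rightarrow> (nat \<Rightarrow> 'v \<Rightarrow> 'v) \<Rightarrow> (nat \<Rightarrow> 'v) topology" where
  "inverse_limit G \<phi> =
     subtopology (product_topology (\<lambda>i. discrete_topology (pverts (G i))) UNIV)
       {x. \<forall>i. x i = \<phi> i (x (Suc i))}"

definition inverse_limit_map ::
    "(nat \<Rightarrow> 'v pair_pre_digraph) \<Rightarrow> (nat \<Rightarrow> 'v \<Rightarrow> 'v) \<Rightarrow> (nat \<Rightarrow> 'v) \<Rightarrow> (nat \<Rightarrow> 'v)" where
  "inverse_limit_map G \<phi> x =
     (THE y. y \<in> topspace (inverse_limit G \<phi>) \<and> (\<forall>i. (x i, y i) \<in> parcs (G i)))"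

lemma in_topspace_inverse_limit:
  "x \<in> topspace (inverse_limit G \<phi>) \<longleftrightarrow>
     (\<forall>i. x i \<in> pverts (G i)) \<and> (\<forall>i. x i = \<phi> i (x (Suc i)))"
  unfolding inverse_limit_def topspace_subtopology topspace_product_topology
    topspace_discrete_topology PiE_UNIV_domain comp_def Int_iff mem_Collect_eq Pi_iff
  by (simp only: UNIV_I simp_thms ball_UNIV)

lemma inverse_limit_map_well_defined:
  assumes cov: "covering G \<phi>" and x: "x \<in> topspace (inverse_limit G \<phi>)"
  shows "\<exists>!y. y \<in> topspace (inverse_limit G \<phi>) \<and> (\<forall>i. (x i, y i) \<in> parcs (G i))"
proof -
  have gr: "covering_graph (G n)" and co: "graph_cover (G (Suc n)) (G n) (\<phi> n)" for n
    using cov unfolding covering_def by blast+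
  have hom: "(\<phi> n u, \<phi> n v) \<in> parcs (G n)" if "(u, v) \<in> parcs (G (Suc n))" for n u v
    using co [of n] that unfolding graph_cover_def graph_hom_def by auto
  have dir: "\<phi> n v = \<phi> n v'" if "(u, v) \<in> parcs (G (Suc n))" "(u, v') \<in> parcs (G (Suc n))"
    for n u v v'
    using co [of n] that unfolding graph_cover_def plus_directional_def by blast
  have wf: "v \<in> pverts (G n)" if "(u, v) \<in> parcs (G n)" for n u v
    using gr [of n] that pair_wf_digraph.in_arcsD2 [of "G n" u v]
    unfolding covering_graph_def pair_fin_digraph_def by blast
  note mem = in_topspace_inverse_limit [THEN iffD1]
  have xV: "x i \<in> pverts (G i)" for i
    using mem [OF x, THEN conjunct1] by (rule spec)
  have xc: "x i = \<phi> i (x (Suc i))" for i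
    using mem [OF x, THEN conjunct2] by (rule spec)
  have "\<exists>w. (x i, w) \<in> parcs (G i)" for i
    using gr [of i] xV [of i] unfolding covering_graph_def by blast
  then obtain w where w: "(x i, w i) \<in> parcs (G i)" for i
    by metis
  define y where "y i = \<phi> i (w (Suc i))" for i
  have xy: "(x i, y i) \<in> parcs (G i)" for i
    using hom [OF w [of "Suc i"]] unfolding y_def xc [of i, symmetric] .
  have yc: "y i = \<phi> i (y (Suc i))" for i
    using dir [OF w [of "Suc i"] xy [of "Suc i"]] unfolding y_def [of i] .
  show ?thesis
  proof (rule ex1I [of _ y])
    show "y \<in> topspace (inverse_limit G \<phi>) \<and> (\<forall>i. (x i, y i) \<in> parcs (G i))"
      unfolding in_topspace_inverse_limit
      by (intro conjI allI wf [OF xy] yc xy)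
  next
    fix z assume z: "z \<in> topspace (inverse_limit G \<phi>) \<and> (\<forall>i. (x i, z i) \<in> parcs (G i))"
    show "z = y"
    proof
      fix i
      have "z i = \<phi> i (z (Suc i))"
        using mem [OF z [THEN conjunct1], THEN conjunct2] by (rule spec)
      also have "\<dots> = \<phi> i (w (Suc i))"
        using z by (intro dir [OF _ w [of "Suc i"]]) blast
      finally show "z i = y i"
        unfolding y_def .
    qed
  qed
qed

section \<open>GM-coverings and topological rank\<close>

text \<open>A circuit of period \<open>l\<close> is the list of its \<open>l + 1\<close> vertices, with the first one
  repeated at the end; its set of edges is \<open>set (vwalk_arcs c)\<close>.\<close>

definition circuit :: "'v pair_pre_digraph \<Rightarrow> 'v list \<Rightarrow> bool" where
  "circuit G c \<longleftrightarrow> vwalk c G \<and> length c \<ge> 2 \<and> hd c = last c \<and> distinct (butlast c)"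

abbreviation period :: "'v list \<Rightarrow> nat" where
  "period c \<equiv> length c - 1"

text \<open>\<open>v n\<close> is the base vertex of \<open>G n\<close>, and \<open>c n i\<close> for \<open>1 \<le> i \<le> l n\<close> are its circuits.
  For \<open>n = 0\<close> these data are irrelevant.\<close>

definition GM_covering ::
    "(nat \<Rightarrow> 'v pair_pre_digraph) \<Rightarrow> (nat \<Rightarrow> 'v \<Rightarrow> 'v) \<Rightarrow>
     (nat \<Rightarrow> 'v) \<Rightarrow> (nat \<Rightarrow> nat) \<Rightarrow> (nat \<Rightarrow> nat \<Rightarrow> 'v list) \<Rightarrow> bool" where
  "GM_covering G \<phi> v l c \<longleftrightarrow> covering G \<phi> \<and>
     (\<forall>n>0.
        v n \<in> pverts (G n) \<and>
        inj_on (c n) {1..l n} \<and>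
        (\<forall>i \<in> {1..l n}. circuit (G n) (c n i) \<and> hd (c n i) = v n) \<and>
        (\<Union>i \<in> {1..l n}. set (vwalk_arcs (c n i))) = parcs (G n) \<and>
        (\<forall>i \<in> {1..l n}. \<forall>i' \<in> {1..l n}.
           \<forall>j \<in> {1..period (c n i)}. \<forall>j' \<in> {1..period (c n i')}.
             c n i ! j = c n i' ! j' \<longrightarrow>
             (\<exists>r. j + r = period (c n i) \<and> j' + r = period (c n i') \<and>
                  (\<forall>k\<le>r. c n i ! (j + k) = c n i' ! (j' + k)))) \<and>
        \<phi> n (v (Suc n)) = v n \<and>
        (\<forall>i \<in> {1..l (Suc n)}. \<phi> n (c (Suc n) i ! 1) = c n 1 ! 1))"

definition GM_simple ::
    "(nat \<Rightarrow> 'v pair_pre_digraph) \<Rightarrow> (nat \<Rightarrow> 'v \<Rightarrow> 'v) \<Rightarrow>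
     (nat \<Rightarrow> nat) \<Rightarrow> (nat \<Rightarrow> nat \<Rightarrow> 'v list) \<Rightarrow> bool" where
  "GM_simple G \<phi> l c \<longleftrightarrow>
     (\<forall>n>0. \<exists>m>n. \<forall>i \<in> {1..l m}.
        set (vwalk_arcs (map (cover_comp \<phi> m n) (c m i))) = parcs (G n))"

definition GM_rank :: "(nat \<Rightarrow> nat) \<Rightarrow> enat" where
  "GM_rank l = liminf (\<lambda>n. enat (l n))"

text \<open>All graphs are finite, so taking natural numbers as vertices loses no covering up to
  isomorphism.\<close>

definition GM_representable :: "'a topology \<Rightarrow> ('a \<Rightarrow> 'a) \<Rightarrow> enat \<Rightarrow> bool" where
  "GM_representable X f K \<longleftrightarrow>
     (\<exists>(G :: nat \<Rightarrow> nat pair_pre_digraph) \<phi> v l c.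
        GM_covering G \<phi> v l c \<and> GM_simple G \<phi> l c \<and> GM_rank l = K \<and>
        conjugate X f (inverse_limit G \<phi>) (inverse_limit_map G \<phi>))"

definition has_topological_rank :: "'a topology \<Rightarrow> ('a \<Rightarrow> 'a) \<Rightarrow> enat \<Rightarrow> bool" where
  "has_topological_rank X f K \<longleftrightarrow>
     GM_representable X f K \<and> (\<forall>K'. GM_representable X f K' \<longrightarrow> K \<le> K')"

end

theory Submission
  imports Defs "HOL-Library.Stream"
begin

(* leaves shift for the map on bi-infinite sequences; on streams it is written as infix @- *)
hide_const (open) Stream.shift

text \<open>
A point \<open>x\<close> of the natural extension has a row at every level \<open>n\<close>: the bi-infinite walk in
\<open>G\<^sub>n\<close> traced by its coordinates. Row \<open>n\<close> is the image of row \<open>n + 1\<close> under \<open>\<phi>\<^sub>n\<close>, and all rows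
together determine \<open>x\<close>. The natural extension is expansive as soon as a single row does
(\<open>expansive_if_coding_injective\<close>): the row at level \<open>n\<close> records which piece of a finite clopen
partition the orbit visits at each time, and different pieces have positive distance.

In a GM-covering a walk in \<open>G\<^sub>m\<close> has no choice away from the base vertex, so it is a
concatenation of the circuits of \<open>G\<^sub>m\<close> (\<open>GM_walk_factorization\<close>). For arbitrarily large \<open>m\<close>
there are at most \<open>K\<close> circuits, and projecting them to level \<open>n \<le> m\<close> shows that all rows at level
\<open>n\<close> factorize over one set of at most \<open>K\<close> finite words. Let \<open>\<rho> n\<close> be the least number of words
over which all rows at level \<open>n\<close> factorize. Projection from level \<open>n + 1\<close> to level \<open>n\<close> carries
factorizations along, so \<open>\<rho>\<close> is monotone; being bounded by \<open>K\<close> it is eventually constant.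

Suppose \<open>\<rho> n = \<rho> (n + 1)\<close> and let \<open>Z\<close> be an optimal set of words at level \<open>n + 1\<close>. Its image
at level \<open>n\<close> is then optimal too. Hence \<open>\<phi>\<^sub>n\<close> is injective on \<open>Z\<close>, and the image is elementary:
it is not contained in the monoid generated by fewer words. By a defect theorem
(\<open>factorization_unique\<close>) an aperiodic bi-infinite word has at most one factorization over an
elementary set. So row \<open>n\<close> determines its cuts, the cuts and \<open>\<phi>\<^sub>n\<close> determine the blocks of row
\<open>n + 1\<close>, and row \<open>n\<close> determines row \<open>n + 1\<close> (\<open>injective_if_coding_number_eq\<close>). From the level on
where \<open>\<rho>\<close> is constant, one row determines all rows (\<open>row_determines_all_rows\<close>).

The defect theorem rests on \<open>omega_hull\<close>, the version for infinite words of the graph lemma of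
combinatorics on words: each nontrivial relation between words of \<open>X\<close>, read only from the left,
saves a generator. For an elementary set it follows that the overlap between two factorizations
determines how they continue to the right (\<open>elementary_deterministic\<close>). As only finitely many
overlaps occur, one of them recurs arbitrarily far to the left. If the factorizations have no
common cut, the word is therefore periodic; a first common cut would have to follow both of two
occurrences of this overlap at the same distance.

Aperiodicity of the rows is where \<open>K > 1\<close> enters. If periodic rows occur at arbitrarily high
levels, then they occur at all levels, and by minimality every level of the system is a rotation
on a finite cycle. The system is then an odometer or a finite cycle, and has rank one
(\<open>periodic_levels.rank_one\<close>).
\<close>

section \<open>A defect theorem for one-sided infinite words\<close>

text \<open>\<open>omega X\<close> is \<open>X\<^sup>\<omega>\<close>, the right-infinite concatenations of words from \<open>X\<close>. The definition has
this meaning only for \<open>[] \<notin> X\<close>.\<close>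

coinductive omega :: "'a list set \<Rightarrow> 'a stream \<Rightarrow> bool" for X where
  omega_shift: "u \<in> X \<Longrightarrow> omega X s \<Longrightarrow> omega X (u @- s)"

lemma omega_concat: "zs \<in> lists Z \<Longrightarrow> omega Z r \<Longrightarrow> omega Z (concat zs @- r)"
  by (induction zs) (auto intro: omega_shift)

lemma omega_star:
  assumes "omega X s" and X: "X \<subseteq> concat ` lists Z" and "[] \<notin> X"
  shows "omega Z s"
proof -
  have "\<exists>us s'. us \<in> lists Z \<and> s = concat us @- s' \<and> omega X s'"
    using assms(1) by (intro exI [of _ "[]"] exI [of _ s]) auto
  then show ?thesis
  proof (coinduction arbitrary: s rule: omega.coinduct)
    case omega
    then obtain us s' where us: "us \<in> lists Z" "s = concat us @- s'" "omega X s'" by blast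
    have "\<exists>z vs t. z \<in> Z \<and> vs \<in> lists Z \<and> omega X t \<and> s = z @- (concat vs @- t)"
    proof (cases us)
      case Nil
      from us(3) obtain u t where u: "s' = u @- t" "u \<in> X" "omega X t" by cases auto
      then obtain vs where vs: "vs \<in> lists Z" "u = concat vs" using X by blast
      with \<open>[] \<notin> X\<close> u obtain z vs' where "vs = z # vs'" by (cases vs) auto
      with vs u us Nil show ?thesis
        by (intro exI [of _ z] exI [of _ vs'] exI [of _ t]) auto
    next
      case (Cons z vs)
      with us show ?thesis
        by (intro exI [of _ z] exI [of _ vs] exI [of _ s']) auto
    qed
    then show ?case by blast
  qed
qed

text \<open>An infinite word over an \<open>\<omega>\<close>-code determines its first factor, and hence, by cancelling it,
its whole factorization.\<close>

definition omega_code :: "'a list set \<Rightarrow> bool" where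
  "omega_code Z \<longleftrightarrow>
     (\<forall>z\<in>Z. \<forall>z'\<in>Z. \<forall>s t. omega Z s \<longrightarrow> omega Z t \<longrightarrow> z @- s = z' @- t \<longrightarrow> z = z')"

lemma shift_eq_prefix:
  assumes "x @- s = y @- t" "length x \<le> length y"
  shows "\<exists>y'. y = x @ y' \<and> s = y' @- t"
  using assms
proof (induction x arbitrary: y)
  case (Cons a x)
  then show ?case by (cases y) auto
qed auto

text \<open>
If two distinct words \<open>x\<close>, \<open>y\<close> of \<open>X\<close> begin the same infinite word over \<open>X\<close>, then one is a prefix
of the other, say \<open>y = x @ y'\<close>, and \<open>y\<close> may be replaced by \<open>y'\<close>. The total length drops, so this
ends with an \<open>\<omega>\<close>-code \<open>Z\<close>. The map \<open>f\<close> to the first factor is what makes the result a counting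
tool: words of \<open>X\<close> that begin a common infinite word have the same image, since \<open>Z\<close> is an
\<open>\<omega>\<close>-code, and surjectivity of \<open>f\<close> then bounds the size of \<open>Z\<close>.
\<close>

lemma omega_hull:
  assumes "finite X" "[] \<notin> X"
  shows "\<exists>Z f. f ` X = Z \<and> [] \<notin> Z \<and> omega_code Z \<and>
               (\<forall>x\<in>X. \<exists>zs\<in>lists Z. f x @ concat zs = x)"
  using assms
proof (induction "sum length X" arbitrary: X rule: less_induct)
  case less
  show ?case
  proof (cases "omega_code X")
    case True
    then show ?thesis
      using less.prems by (intro exI [of _ X] exI [of _ "\<lambda>x. x"]) (auto intro: bexI [of _ "[]"])
  next
    case False
    then obtain x1 x2 s1 s2 where "x1 \<in> X" "x2 \<in> X" "omega X s1" "omega X s2"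
      "x1 @- s1 = x2 @- s2" "x1 \<noteq> x2"
      unfolding omega_code_def by blast
    then obtain x y s t where xy: "x \<in> X" "y \<in> X" "omega X s" "omega X t" "x @- s = y @- t"
      "x \<noteq> y" "length x \<le> length y"
      by (cases "length x1 \<le> length x2") (fastforce, metis nat_le_linear)
    then obtain y' where y': "y = x @ y'" "s = y' @- t"
      using shift_eq_prefix by blast
    have "y' \<noteq> []" and "x \<noteq> []" using xy y' less.prems by auto
    define X' where "X' = insert y' (X - {y})"
    have "sum length X' \<le> length y' + sum length (X - {y})"
      using less.prems by (simp add: X'_def sum.insert_if)
    also have "\<dots> < length y + sum length (X - {y})"
      using y' \<open>x \<noteq> []\<close> by simp
    also have "\<dots> = sum length X"
      using xy less.prems by (simp add: sum.remove [of X y])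
    finally have "sum length X' < sum length X" .
    moreover have "finite X'" "[] \<notin> X'"
      using less.prems \<open>y' \<noteq> []\<close> by (auto simp: X'_def)
    ultimately obtain Z f' where Z: "f' ` X' = Z" "[] \<notin> Z" "omega_code Z"
      and f': "\<And>u. u \<in> X' \<Longrightarrow> \<exists>zs\<in>lists Z. f' u @ concat zs = u"
      using less.hyps [of X'] by blast
    define f where "f u = (if u = y then f' x else f' u)" for u
    have xX': "x \<in> X'" and y'X': "y' \<in> X'" using xy by (auto simp: X'_def)
    have f: "\<exists>zs\<in>lists Z. f u @ concat zs = u" if "u \<in> X" for u
    proof (cases "u = y")
      case True
      obtain zs zs' where "zs \<in> lists Z" "f' x @ concat zs = x"
        "zs' \<in> lists Z" "f' y' @ concat zs' = y'"
        using f' [OF xX'] f' [OF y'X'] by blast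
      moreover from this have "f y @ concat (zs @ f' y' # zs') = y"
        by (simp add: f_def y'(1) flip: append_assoc)
      moreover have "f' y' \<in> Z" using Z(1) y'X' by blast
      ultimately have "\<exists>vs\<in>lists Z. f y @ concat vs = y"
        by (intro bexI [of _ "zs @ f' y' # zs'"]) auto
      then show ?thesis using True by blast
    next
      case False
      then show ?thesis using f' [of u] that by (simp add: f_def X'_def)
    qed
    have fZ: "f u \<in> Z" if "u \<in> X" for u
      using that Z(1) xX' by (auto simp: f_def X'_def)
    have "X \<subseteq> concat ` lists Z"
    proof
      fix u assume "u \<in> X"
      then obtain zs where "zs \<in> lists Z" "f u @ concat zs = u" using f by blast
      then show "u \<in> concat ` lists Z"
        using fZ [OF \<open>u \<in> X\<close>] by (intro image_eqI [of _ _ "f u # zs"]) auto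
    qed
    then have om: "omega Z r" if "omega X r" for r
      using omega_star that less.prems by blast
    \<comment> \<open>The generator \<open>f' y'\<close> is not lost: \<open>s\<close> begins with \<open>y'\<close> and also with a word \<open>u\<close> of \<open>X\<close>,
        so \<open>u\<close> and \<open>y'\<close> have the same first factor.\<close>
    from xy(3) obtain u s' where u: "s = u @- s'" "u \<in> X" "omega X s'" by cases auto
    obtain zs where zs: "zs \<in> lists Z" "f u @ concat zs = u" using f [OF u(2)] by blast
    obtain zs' where zs': "zs' \<in> lists Z" "f' y' @ concat zs' = y'" using f' y'X' by blast
    have "f u @- (concat zs @- s') = f' y' @- (concat zs' @- t)"
      using u(1) y'(2) zs(2) zs'(2) by (metis shift_append)
    moreover have "f' y' \<in> Z" using Z(1) y'X' by blast
    ultimately have "f u = f' y'"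
      using Z(3) fZ [OF u(2)] omega_concat [OF zs(1) om [OF u(3)]] omega_concat [OF zs'(1) om [OF xy(4)]]
      unfolding omega_code_def by blast
    then have "f' y' \<in> f ` X" using u(2) by (metis imageI)
    moreover have "f' v \<in> f ` X" if "v \<in> X - {y}" for v
      using that by (intro image_eqI [of _ _ v]) (auto simp: f_def)
    ultimately have "f' v \<in> f ` X" if "v \<in> X'" for v
      using that unfolding X'_def by (cases "v = y'") simp_all
    then have "Z \<subseteq> f ` X"
      unfolding Z(1) [symmetric] by (rule image_subsetI)
    moreover have "f ` X \<subseteq> Z" using fZ by (rule image_subsetI)
    ultimately have "f ` X = Z" by (intro equalityI)
    show ?thesis
      by (intro exI [of _ Z] exI [of _ f] conjI ballI) (fact Z \<open>f ` X = Z\<close> f)+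
  qed
qed

text \<open>For finite \<open>X\<close> without the empty word this says that the combinatorial rank of \<open>X\<close>, the least
size of a set of words that generates a monoid containing \<open>X\<close>, is \<open>card X\<close>.\<close>

definition elementary :: "'a list set \<Rightarrow> bool" where
  "elementary X \<longleftrightarrow>
     (\<forall>Z. finite Z \<longrightarrow> [] \<notin> Z \<longrightarrow> X \<subseteq> concat ` lists Z \<longrightarrow> card X \<le> card Z)"

text \<open>
In the hull of \<open>insert s X\<close> the words \<open>s\<close>, \<open>y\<close> and \<open>y'\<close> have the same first factor. If
\<open>y \<noteq> y'\<close>, then this saves two of the \<open>card X + 1\<close> words when \<open>s\<close> is new, and one of the
\<open>card X\<close> words when \<open>s \<in> X\<close>. Both contradict that \<open>X\<close> is elementary. In the proof the two cases
are one: the hull is the image of \<open>X - {y}\<close>.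
\<close>

lemma elementary_deterministic:
  assumes X: "finite X" "[] \<notin> X" "elementary X" and "s \<noteq> []"
    and y: "y \<in> X" "omega X a" "omega X b" "s @- a = y @- b"
    and y': "y' \<in> X" "omega X a'" "omega X b'" "s @- a' = y' @- b'"
  shows "y = y'"
proof (rule ccontr)
  assume "y \<noteq> y'"
  let ?X = "insert s X"
  have "finite ?X" "[] \<notin> ?X" using X \<open>s \<noteq> []\<close> by auto
  then obtain Z f where Z: "f ` ?X = Z" "[] \<notin> Z" "omega_code Z"
    and f: "\<And>x. x \<in> ?X \<Longrightarrow> \<exists>zs\<in>lists Z. f x @ concat zs = x"
    using omega_hull [of ?X] by blast
  have star: "?X \<subseteq> concat ` lists Z"
  proof
    fix u assume u: "u \<in> ?X"
    then obtain zs where "zs \<in> lists Z" "f u @ concat zs = u" using f [of u] by blast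
    moreover have "f u \<in> Z" using Z(1) u by blast
    ultimately show "u \<in> concat ` lists Z"
      by (intro image_eqI [of _ _ "f u # zs"]) auto
  qed
  have om: "omega Z r" if "omega X r" for r
    using omega_star [OF that _ X(2)] star by simp
  have same: "f s = f u" if u: "u \<in> X" "omega X r" "omega X r'" "s @- r = u @- r'" for u r r'
  proof -
    obtain zs where zs: "zs \<in> lists Z" "f s @ concat zs = s" using f [OF insertI1] by blast
    obtain zs' where zs': "zs' \<in> lists Z" "f u @ concat zs' = u" using f [OF insertI2, OF u(1)] by blast
    have "f s @- (concat zs @- r) = f u @- (concat zs' @- r')"
      using u(4) zs(2) zs'(2) by (metis shift_append)
    moreover have "f s \<in> Z" "f u \<in> Z" using Z(1) u by blast+
    ultimately show ?thesis
      using Z(3) omega_concat [OF zs(1) om [OF u(2)]] omega_concat [OF zs'(1) om [OF u(3)]]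
      unfolding omega_code_def by blast
  qed
  have fy: "f s = f y" "f s = f y'" using same y y' by blast+
  have "card X \<le> card Z"
  proof -
    have "finite Z" using \<open>finite ?X\<close> Z(1) by blast
    then show ?thesis using X(3) Z(2) star unfolding elementary_def by blast
  qed
  moreover have "Z = f ` (X - {y})"
  proof -
    have "y' \<in> X - {y}" using y'(1) \<open>y \<noteq> y'\<close> by blast
    then have "f s \<in> f ` (X - {y})" "f y \<in> f ` (X - {y})" using fy by (metis imageI)+
    then show ?thesis using Z(1) by auto
  qed
  then have "card Z \<le> card (X - {y})"
    using X(1) by (simp add: card_image_le)
  moreover have "card (X - {y}) < card X"
    using X(1) y(1) by (meson card_Diff1_less)
  ultimately show False by simp
qed

section \<open>Factorizations of bi-infinite words\<close>

definition segment :: "(int \<Rightarrow> 'a) \<Rightarrow> int \<Rightarrow> int \<Rightarrow> 'a list" where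
  "segment w p q = map w [p..q - 1]"

definition tail :: "(int \<Rightarrow> 'a) \<Rightarrow> int \<Rightarrow> 'a stream" where
  "tail w p = smap (\<lambda>k. w (p + int k)) nats"

definition consecutive :: "int set \<Rightarrow> int \<Rightarrow> int \<Rightarrow> bool" where
  "consecutive C p q \<longleftrightarrow> p \<in> C \<and> q \<in> C \<and> p < q \<and> (\<forall>r\<in>C. \<not> (p < r \<and> r < q))"

text \<open>A factorization is given by the set of its cuts, that is, the positions where a factor begins;
the factors are the segments between consecutive cuts.\<close>

definition factorization :: "'a list set \<Rightarrow> (int \<Rightarrow> 'a) \<Rightarrow> int set \<Rightarrow> bool" where
  "factorization X w C \<longleftrightarrow>
     (\<forall>i. \<exists>p\<in>C. p \<le> i) \<and> (\<forall>i. \<exists>p\<in>C. i < p) \<and>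
     (\<forall>p q. consecutive C p q \<longrightarrow> segment w p q \<in> X)"

lemma length_segment [simp]: "length (segment w p q) = nat (q - p)"
  by (simp add: segment_def)

lemma nth_segment [simp]: "k < nat (q - p) \<Longrightarrow> segment w p q ! k = w (p + int k)"
  by (simp add: segment_def)

lemma segment_eq_iff:
  assumes "p \<le> q" "p' \<le> q'"
  shows "segment w p q = segment w' p' q' \<longleftrightarrow>
         q - p = q' - p' \<and> (\<forall>k. 0 \<le> k \<and> k < q - p \<longrightarrow> w (p + k) = w' (p' + k))"
proof
  assume eq: "segment w p q = segment w' p' q'"
  have l: "q - p = q' - p'" using assms arg_cong [OF eq, of length] by simp
  moreover have "w (p + k) = w' (p' + k)" if "0 \<le> k" "k < q - p" for k
  proof -
    have "segment w p q ! nat k = segment w' p' q' ! nat k" using eq by simp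
    then show ?thesis using that l by simp
  qed
  ultimately show "q - p = q' - p' \<and> (\<forall>k. 0 \<le> k \<and> k < q - p \<longrightarrow> w (p + k) = w' (p' + k))"
    by blast
next
  assume "q - p = q' - p' \<and> (\<forall>k. 0 \<le> k \<and> k < q - p \<longrightarrow> w (p + k) = w' (p' + k))"
  then show "segment w p q = segment w' p' q'"
    by (intro nth_equalityI) auto
qed

lemma segment_map: "segment (\<lambda>i. g (w i)) p q = map g (segment w p q)"
  by (simp add: segment_def)

lemma tail_split:
  assumes "p \<le> q"
  shows "tail w p = segment w p q @- tail w q"
proof -
  have "tail w p !! k = (segment w p q @- tail w q) !! k" for k
    using assms by (cases "k < nat (q - p)") (auto simp: tail_def add.commute)
  then have "smap ((!!) (tail w p)) nats = smap ((!!) (segment w p q @- tail w q)) nats"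
    by presburger
  then show ?thesis by (simp flip: stream_smap_nats)
qed

lemma consecutive_around:
  assumes "\<exists>a\<in>C. a \<le> i" "\<exists>b\<in>C. i < b"
  obtains p q where "consecutive C p q" "p \<le> i" "i < q"
proof -
  obtain a b where ab: "a \<in> C" "a \<le> i" "b \<in> C" "i < b" using assms by blast
  let ?A = "C \<inter> {a..i}" and ?B = "C \<inter> {i<..b}"
  have fin: "finite ?A" "finite ?B" by auto
  have A: "Max ?A \<in> ?A" and B: "Min ?B \<in> ?B"
    using ab by (intro Max_in Min_in fin; auto)+
  have "consecutive C (Max ?A) (Min ?B)"
    unfolding consecutive_def
  proof (intro conjI ballI notI)
    fix r assume r: "r \<in> C" "Max ?A < r \<and> r < Min ?B"
    show False
    proof (cases "r \<le> i")
      case True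
      then have "r \<in> ?A" using r A by auto
      then show False using Max_ge [OF fin(1) \<open>r \<in> ?A\<close>] r by linarith
    next
      case False
      then have "r \<in> ?B" using r B by auto
      then show False using Min_le [OF fin(2) \<open>r \<in> ?B\<close>] r by linarith
    qed
  qed (use A B in auto)
  then show ?thesis using that A B by auto
qed

lemma factorization_around:
  assumes "factorization X w C"
  obtains p q where "consecutive C p q" "p \<le> i" "i < q"
  using consecutive_around [of C i] assms unfolding factorization_def by metis

lemma factorization_next:
  assumes "factorization X w C" "p \<in> C"
  obtains q where "consecutive C p q"
proof -
  obtain p' q where "consecutive C p' q" "p' \<le> p" "p < q"
    using factorization_around [OF assms(1)] .
  moreover then have "p' = p" using assms(2) by (force simp: consecutive_def)
  ultimately show ?thesis using that by blast
qed

lemma omega_tail: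
  assumes "factorization X w C" "p \<in> C"
  shows "omega X (tail w p)"
proof -
  have "\<exists>q\<in>C. tail w p = tail w q" using assms by blast
  then show ?thesis
  proof (coinduction arbitrary: p rule: omega.coinduct)
    case (omega p)
    then obtain q where q: "q \<in> C" "tail w p = tail w q" by blast
    obtain r where r: "consecutive C q r" using factorization_next [OF assms(1) q(1)] .
    then have "segment w q r \<in> X" using assms(1) by (simp add: factorization_def)
    moreover have "tail w p = segment w q r @- tail w r"
      using q r tail_split [of q r w] by (simp add: consecutive_def)
    ultimately show ?case using r by (auto simp: consecutive_def)
  qed
qed

lemma segment_drop:
  assumes "p \<le> a" "a \<le> q" "p' \<le> q'"
    and "segment w p q = segment w p' q'" and "a - p = a' - p'"
  shows "segment w a q = segment w a' q'"
proof -
  have eq: "q - p = q' - p'" "\<And>k. 0 \<le> k \<Longrightarrow> k < q - p \<Longrightarrow> w (p + k) = w (p' + k)"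
    using assms segment_eq_iff [of p q p' q' w w] by auto
  have "w (a + k) = w (a' + k)" if "0 \<le> k" "k < q - a" for k
  proof -
    have "a + k = p + (a - p + k)" "a' + k = p' + (a - p + k)" using assms by auto
    moreover have "w (p + (a - p + k)) = w (p' + (a - p + k))"
      using that assms by (intro eq(2)) auto
    ultimately show ?thesis by metis
  qed
  then show ?thesis
    using assms eq(1) segment_eq_iff [of a q a' q' w w] by auto
qed

section \<open>Uniqueness of factorizations of aperiodic words\<close>

locale two_factorizations =
  fixes X :: "'a list set" and w :: "int \<Rightarrow> 'a" and C D :: "int set"
  assumes X: "finite X" "[] \<notin> X" "elementary X"
    and C: "factorization X w C" and D: "factorization X w D"
begin

text \<open>An overlap runs from a cut of one factorization to a later cut of the other one. The roles of
the two factorizations alternate while the overlap moves to the right, so both orders occur.\<close>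

definition overlap :: "int set \<Rightarrow> int set \<Rightarrow> int \<Rightarrow> int \<Rightarrow> bool" where
  "overlap A B p q \<longleftrightarrow> (A, B) \<in> {(C, D), (D, C)} \<and> p \<in> A \<and> q \<in> B \<and> p < q"

text \<open>Both the block that begins at the left end of an overlap and the overlap itself begin the same
infinite word, so \<open>elementary_deterministic\<close> applies. This also covers overlaps that end at a
common cut.\<close>

lemma block_determined:
  assumes o: "overlap A B p q" and o': "overlap A' B' p' q'"
    and eq: "segment w p q = segment w p' q'"
    and a: "consecutive A p a" and a': "consecutive A' p' a'"
  shows "segment w p a = segment w p' a'" "a - p = a' - p'" "q - p = q' - p'"
proof -
  have pq: "p < q" "p' < q'" "p < a" "p' < a'"
    using o o' a a' by (auto simp: overlap_def consecutive_def)
  have "factorization X w A" "factorization X w A'" "factorization X w B" "factorization X w B'"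
    using o o' C D by (auto simp: overlap_def)
  moreover have "q \<in> B" "a \<in> A" "q' \<in> B'" "a' \<in> A'"
    using o o' a a' by (auto simp: overlap_def consecutive_def)
  ultimately have om: "omega X (tail w q)" "omega X (tail w a)"
      "omega X (tail w q')" "omega X (tail w a')"
    and blocks: "segment w p a \<in> X" "segment w p' a' \<in> X"
    using a a' by (simp_all add: omega_tail factorization_def)
  have "segment w p q \<noteq> []" using pq by (metis length_segment list.size(3) zero_less_nat_eq
        diff_gt_0_iff_gt less_irrefl)
  moreover have "segment w p q @- tail w q = segment w p a @- tail w a"
    "segment w p q @- tail w q' = segment w p' a' @- tail w a'"
    using tail_split [of p q w] tail_split [of p a w] tail_split [of p' q' w] tail_split [of p' a' w]
      pq eq by auto
  ultimately show "segment w p a = segment w p' a'"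
    using elementary_deterministic [OF X, of "segment w p q"] om blocks by blast
  then show "a - p = a' - p'" using segment_eq_iff pq by (metis less_imp_le)
  show "q - p = q' - p'" using eq segment_eq_iff pq by (metis less_imp_le)
qed

text \<open>Removing the shorter of the overlap and the block at its left end leaves a new overlap further
to the right, and by \<open>block_determined\<close> this happens at equal overlaps in the same way. A common cut
would stop the process, as nothing would be left.\<close>

lemma same_overlap_same_future:
  assumes disj: "C \<inter> D = {}"
  shows "overlap A B p q \<Longrightarrow> overlap A' B' p' q' \<Longrightarrow> segment w p q = segment w p' q' \<Longrightarrow>
    w (p + int k) = w (p' + int k)"
proof (induction k arbitrary: A B A' B' p q p' q' rule: less_induct)
  case (less k)
  obtain a where a: "consecutive A p a"
    using less.prems(1) C D factorization_next unfolding overlap_def by blast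
  obtain a' where a': "consecutive A' p' a'"
    using less.prems(2) C D factorization_next unfolding overlap_def by blast
  note det = block_determined [OF less.prems a a']
  have pq: "p < q" "p' < q'" "p < a" "p' < a'" "a \<in> A" "q \<in> B"
    using less.prems a a' by (auto simp: overlap_def consecutive_def)
  have "a \<noteq> q" using less.prems(1) pq disj by (auto simp: overlap_def)
  show ?case
  proof (cases "int k < q - p")
    case True
    then show ?thesis
      using less.prems(3) pq segment_eq_iff [of p q p' q' w w] by auto
  next
    case k: False
    show ?thesis
    proof (cases "a < q")
      case True
      have "overlap A B a q" "overlap A' B' a' q'"
        using True det less.prems a a' by (auto simp: overlap_def consecutive_def)
      moreover have "segment w a q = segment w a' q'"
        using segment_drop [of p a q p' q' w a'] less.prems(3) det True pq by auto
      ultimately have "w (a + int (k - nat (a - p))) = w (a' + int (k - nat (a - p)))"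
        using less.IH [of "k - nat (a - p)"] pq k True by auto
      moreover have "a + int (k - nat (a - p)) = p + int k" "a' + int (k - nat (a - p)) = p' + int k"
        using k True det pq by linarith+
      ultimately show ?thesis by metis
    next
      case False
      then have "overlap B A q a" "overlap B' A' q' a'"
        using \<open>a \<noteq> q\<close> det less.prems a a' by (auto simp: overlap_def consecutive_def)
      moreover have "segment w q a = segment w q' a'"
        using segment_drop [of p q a p' a' w q'] det False pq by auto
      ultimately have "w (q + int (k - nat (q - p))) = w (q' + int (k - nat (q - p)))"
        using less.IH [of "k - nat (q - p)"] pq k by auto
      moreover have "q + int (k - nat (q - p)) = p + int k" "q' + int (k - nat (q - p)) = p' + int k"
        using k det pq by linarith+
      ultimately show ?thesis by metis
    qed
  qed
qed

text \<open>When there are common cuts, equal overlaps to the left of the first one evolve in the same way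
and reach it after the same distance, so they are at the same place.\<close>

lemma same_overlap_same_meeting:
  assumes q0: "q0 \<in> C \<inter> D" "\<And>r. r \<in> C \<inter> D \<Longrightarrow> q0 \<le> r"
  shows "overlap A B p q \<Longrightarrow> overlap A' B' p' q' \<Longrightarrow> segment w p q = segment w p' q' \<Longrightarrow>
    q \<le> q0 \<Longrightarrow> q' \<le> q0 \<Longrightarrow> p = p'"
proof (induction "nat (q0 - p)" arbitrary: A B A' B' p q p' q' rule: less_induct)
  case less
  obtain a where a: "consecutive A p a"
    using less.prems(1) C D factorization_next unfolding overlap_def by blast
  obtain a' where a': "consecutive A' p' a'"
    using less.prems(2) C D factorization_next unfolding overlap_def by blast
  note det = block_determined [OF less.prems(1-3) a a']
  have pq: "p < q" "p' < q'" "p < a" "p' < a'" "a \<in> A" "q \<in> B" "a' \<in> A'" "q' \<in> B'"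
    using less.prems a a' by (auto simp: overlap_def consecutive_def)
  have "q0 \<in> A" "q0 \<in> A'" using q0(1) less.prems(1,2) by (auto simp: overlap_def)
  then have le: "a \<le> q0" "a' \<le> q0" using a a' pq less.prems by (auto simp: consecutive_def)
  consider "a = q" | "a < q" | "a > q" by linarith
  then show ?case
  proof cases
    case 1
    then have "a' = q'" using det by simp
    then have "q0 \<le> q" "q0 \<le> q'"
      using 1 pq less.prems(1,2) by (intro q0(2); auto simp: overlap_def)+
    then show ?thesis using less.prems det by simp
  next
    case 2
    have "overlap A B a q" "overlap A' B' a' q'"
      using 2 det less.prems a a' by (auto simp: overlap_def consecutive_def)
    moreover have "segment w a q = segment w a' q'"
      using segment_drop [of p a q p' q' w a'] less.prems(3) det 2 pq by auto
    ultimately have "a = a'"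
      using less.hyps [of a A B q A' B' a' q'] pq le less.prems by auto
    then show ?thesis using det by simp
  next
    case 3
    then have "overlap B A q a" "overlap B' A' q' a'"
      using det less.prems a a' by (auto simp: overlap_def consecutive_def)
    moreover have "segment w q a = segment w q' a'"
      using segment_drop [of p q a p' a' w q'] det 3 pq by auto
    ultimately have "q = q'"
      using less.hyps [of q B A a B' A' q' a'] pq le less.prems by auto
    then show ?thesis using det by simp
  qed
qed

text \<open>Elementary sets are \<open>\<omega>\<close>-codes: take the first block as the overlap in
\<open>elementary_deterministic\<close>.\<close>

lemma same_after_common:
  assumes "r0 \<in> C \<inter> D" "r0 \<le> r"
  shows "r \<in> C \<longleftrightarrow> r \<in> D"
  using assms
proof (induction "nat (r - r0)" arbitrary: r0 rule: less_induct)
  case less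
  show ?case
  proof (cases "r = r0")
    case True
    then show ?thesis using less.prems by auto
  next
    case False
    obtain a where a: "consecutive C r0 a" using factorization_next [OF C] less.prems by blast
    obtain b where b: "consecutive D r0 b" using factorization_next [OF D] less.prems by blast
    have ab: "r0 < a" "r0 < b" "a \<in> C" "b \<in> D" using a b by (auto simp: consecutive_def)
    have "segment w r0 a \<noteq> []" using ab
      by (metis length_segment list.size(3) zero_less_nat_eq diff_gt_0_iff_gt less_irrefl)
    moreover have "segment w r0 a \<in> X" "segment w r0 b \<in> X"
      using a b C D by (auto simp: factorization_def)
    moreover have "segment w r0 a @- tail w a = segment w r0 b @- tail w b"
      using tail_split [of r0 a w] tail_split [of r0 b w] ab by simp
    ultimately have "segment w r0 a = segment w r0 b"
      using elementary_deterministic [OF X, of "segment w r0 a"]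
        omega_tail [OF C \<open>a \<in> C\<close>] omega_tail [OF D \<open>b \<in> D\<close>] by blast
    then have "a = b" using ab segment_eq_iff [of r0 a r0 b w w] by simp
    show ?thesis
    proof (cases "a \<le> r")
      case True
      then show ?thesis using less.hyps [of a] ab \<open>a = b\<close> False less.prems by auto
    next
      case False
      then show ?thesis
        using a b \<open>a = b\<close> \<open>r \<noteq> r0\<close> less.prems(2) unfolding consecutive_def by force
    qed
  qed
qed

text \<open>For each cut \<open>p\<close> of \<open>C\<close> take the overlap up to the next cut of \<open>D\<close>. It is no longer than the
longest word of \<open>X\<close>, so there are only finitely many overlaps, and some \<open>s\<close> occurs infinitely often to
the left of \<open>b\<close>.\<close>

lemma repeated_overlap:
  obtains T s where "infinite T" "T \<subseteq> C \<inter> {..<b}"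
    "\<And>p. p \<in> T \<Longrightarrow> \<exists>q. overlap C D p q \<and> segment w p q = s \<and> (\<forall>r\<in>D. p < r \<longrightarrow> q \<le> r)"
proof -
  let ?M = "Max (length ` X)" and ?L = "\<Union>(set ` X)"
  let ?S = "{s. set s \<subseteq> ?L \<and> length s \<le> ?M}"
  have "finite ?S" using X(1) by (intro finite_lists_length_le) auto
  have lets: "w i \<in> ?L" for i
  proof -
    obtain p q where pq: "consecutive C p q" "p \<le> i" "i < q" using factorization_around [OF C] .
    then have "segment w p q \<in> X" using C by (simp add: factorization_def)
    moreover have "w i \<in> set (segment w p q)" using pq by (auto simp: segment_def)
    ultimately show ?thesis by blast
  qed
  let ?P = "\<lambda>p s. \<exists>q. overlap C D p q \<and> segment w p q = s \<and> (\<forall>r\<in>D. p < r \<longrightarrow> q \<le> r)"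
  have "\<exists>s. s \<in> ?S \<and> ?P p s" if "p \<in> C" for p
  proof -
    obtain a q where q: "consecutive D a q" "a \<le> p" "p < q" using factorization_around [OF D] .
    then have "segment w a q \<in> X" using D by (simp add: factorization_def)
    then have "length (segment w a q) \<le> ?M" using Max_ge [OF finite_imageI [OF X(1)] imageI] by blast
    then have "segment w p q \<in> ?S" using q lets by (auto simp: segment_def)
    moreover have "overlap C D p q" using q that by (auto simp: overlap_def consecutive_def)
    moreover have "\<forall>r\<in>D. p < r \<longrightarrow> q \<le> r" using q by (force simp: consecutive_def)
    ultimately have "segment w p q \<in> ?S \<and> ?P p (segment w p q)" by blast
    then show ?thesis by (rule exI)
  qed
  then have "\<forall>p\<in>C. \<exists>s. s \<in> ?S \<and> ?P p s" by (rule ballI)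
  from bchoice [OF this] obtain g where "\<forall>p\<in>C. g p \<in> ?S \<and> ?P p (g p)" by (rule exE)
  then have g: "\<And>p. p \<in> C \<Longrightarrow> g p \<in> ?S \<and> ?P p (g p)" by (rule bspec)
  let ?A = "C \<inter> {..<b}"
  have "infinite ?A"
  proof
    assume fin: "finite ?A"
    obtain p where "p \<in> C" "p \<le> b - 1" using C unfolding factorization_def by blast
    then have "p \<in> ?A" by auto
    obtain p' where "p' \<in> C" "p' \<le> Min ?A - 1" using C unfolding factorization_def by blast
    moreover have "Min ?A \<le> p" using fin \<open>p \<in> ?A\<close> by simp
    ultimately have "p' \<in> ?A" using \<open>p \<in> ?A\<close> by auto
    then have "Min ?A \<le> p'" using fin by simp
    then show False using \<open>p' \<le> Min ?A - 1\<close> by simp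
  qed
  moreover have "g ` ?A \<subseteq> ?S"
    by (rule image_subsetI) (rule g [THEN conjunct1], erule IntD1)
  then have "finite (g ` ?A)" using \<open>finite ?S\<close> by (rule finite_subset)
  ultimately obtain p0 where "p0 \<in> ?A" "infinite {p \<in> ?A. g p = g p0}"
    using pigeonhole_infinite by blast
  moreover have "\<exists>q. overlap C D p q \<and> segment w p q = g p0 \<and> (\<forall>r\<in>D. p < r \<longrightarrow> q \<le> r)"
    if "p \<in> {p \<in> ?A. g p = g p0}" for p
  proof -
    have "p \<in> C" "g p = g p0" using that by auto
    then show ?thesis using g [THEN conjunct2, of p] by simp
  qed
  ultimately show ?thesis
    by (intro that [of "{p \<in> ?A. g p = g p0}" "g p0"]) auto
qed

end

text \<open>
Without common cuts, an overlap that recurs infinitely often towards the left always has the same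
future, which makes the word periodic. With common cuts, two different factorizations agree from
the first common cut on, and an overlap that recurs to the left of this cut contradicts
\<open>same_overlap_same_meeting\<close>.
\<close>

theorem factorization_unique:
  assumes X: "finite X" "[] \<notin> X" "elementary X"
    and fact: "factorization X w C" "factorization X w D"
    and aper: "\<And>d. d > 0 \<Longrightarrow> \<exists>i. w (i + d) \<noteq> w i"
  shows "C = D"
proof (rule ccontr)
  assume "C \<noteq> D"
  interpret two_factorizations X w C D by standard fact+
  show False
  proof (cases "C \<inter> D = {}")
    case True
    obtain T s where T: "infinite T" "T \<subseteq> C \<inter> {..<0}"
      and ov: "\<And>p. p \<in> T \<Longrightarrow> \<exists>q. overlap C D p q \<and> segment w p q = s \<and> (\<forall>r\<in>D. p < r \<longrightarrow> q \<le> r)"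
      by (rule repeated_overlap [of 0]) (rule that, assumption+)
    have same: "w (p + int k) = w (p' + int k)" if "p \<in> T" "p' \<in> T" for p p' k
      using ov [OF that(1)] ov [OF that(2)] same_overlap_same_future [OF True] by metis
    obtain p1 where p1: "p1 \<in> T" using T(1) by (metis finite.emptyI ex_in_conv)
    have unb: "\<exists>p\<in>T. p < i" for i
    proof (rule ccontr)
      assume "\<not> ?thesis"
      then have "T \<subseteq> {i..0}" using T(2) by force
      then show False using T(1) finite_subset by blast
    qed
    obtain p2 where p2: "p2 \<in> T" "p2 < p1" using unb by blast
    have "w (i + (p1 - p2)) = w i" for i
    proof -
      obtain p where p: "p \<in> T" "p < i" using unb by blast
      define k where "k = nat (i - p)"
      have "w (i + (p1 - p2)) = w (p + int (k + nat (p1 - p2)))"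
        using p p2 by (simp add: k_def algebra_simps)
      also have "\<dots> = w (p2 + int (k + nat (p1 - p2)))" using same p p2 by blast
      also have "\<dots> = w (p1 + int k)" using p2 by (simp add: algebra_simps)
      also have "\<dots> = w (p + int k)" using same p p1 by blast
      also have "\<dots> = w i" using p by (simp add: k_def)
      finally show ?thesis .
    qed
    then show False using aper [of "p1 - p2"] p2 by auto
  next
    case False
    obtain z where z: "z \<in> C \<longleftrightarrow> z \<notin> D" using \<open>C \<noteq> D\<close> by blast
    have above: "z < r" if "r \<in> C \<inter> D" for r
      using same_after_common [OF that, of z] z by force
    obtain y where y: "y \<in> C \<inter> D" using False by blast
    define n0 where "n0 = (LEAST n. z + int n \<in> C \<inter> D)"
    have ex: "z + int (nat (y - z)) \<in> C \<inter> D" using y above [OF y] by simp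
    have q0: "z + int n0 \<in> C \<inter> D" unfolding n0_def using ex by (rule LeastI)
    have min: "z + int n0 \<le> r" if "r \<in> C \<inter> D" for r
    proof -
      have "n0 \<le> nat (r - z)" unfolding n0_def
        using that above [OF that] by (intro Least_le) simp
      then show ?thesis using above [OF that] by simp
    qed
    obtain T s where T: "infinite T" "T \<subseteq> C \<inter> {..<z + int n0}"
      and ov: "\<And>p. p \<in> T \<Longrightarrow> \<exists>q. overlap C D p q \<and> segment w p q = s \<and> (\<forall>r\<in>D. p < r \<longrightarrow> q \<le> r)"
      by (rule repeated_overlap [of "z + int n0"]) (rule that, assumption+)
    have "p = p'" if pT: "p \<in> T" "p' \<in> T" for p p'
    proof -
      obtain q q' where "overlap C D p q" "segment w p q = s" "q \<le> z + int n0"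
        "overlap C D p' q'" "segment w p' q' = s" "q' \<le> z + int n0"
        using ov [OF pT(1)] ov [OF pT(2)] T(2) pT q0 by blast
      then show ?thesis using same_overlap_same_meeting [OF q0 min] by metis
    qed
    then have "\<exists>p. T \<subseteq> {p}" by blast
    then show False using T(1) finite_subset by blast
  qed
qed

section \<open>Coding numbers\<close>

lemma factorization_map:
  assumes "factorization Z w C"
  shows "factorization (map g ` Z) (g \<circ> w) C"
  using assms segment_map [of g w] by (auto simp: factorization_def comp_def)

lemma segment_infix:
  assumes "segment w p q = a @ b @ c" "p \<le> q"
  shows "segment w (p + int (length a)) (p + int (length a) + int (length b)) = b"
proof (rule nth_equalityI)
  fix k assume "k < length (segment w (p + int (length a)) (p + int (length a) + int (length b)))"
  then have k: "k < length b" by simp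
  have "nat (q - p) = length a + length b + length c"
    using arg_cong [OF assms(1), of length] by simp
  moreover have "segment w p q ! (length a + k) = b ! k"
    using assms(1) k by (simp add: nth_append)
  ultimately show "segment w (p + int (length a)) (p + int (length a) + int (length b)) ! k = b ! k"
    using k by (simp add: add.assoc)
qed simp

lemma factorization_refine:
  assumes fact: "factorization X w C" and X: "X \<subseteq> concat ` lists Z" and Z: "[] \<notin> Z"
  shows "\<exists>D. factorization Z w D"
proof -
  have "\<exists>us. us \<in> lists Z \<and> concat us = u" if "u \<in> X" for u
    using that X by blast
  then have "\<forall>u\<in>X. \<exists>us. us \<in> lists Z \<and> concat us = u" by (rule ballI)
  from bchoice [OF this] obtain dec
    where "\<forall>u\<in>X. dec u \<in> lists Z \<and> concat (dec u) = u" by (rule exE)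
  then have dec: "dec u \<in> lists Z" "concat (dec u) = u" if "u \<in> X" for u using that by simp_all
  \<comment> \<open>The new cuts in the block from \<open>p\<close> to \<open>q\<close> are the ends of the first \<open>k\<close> factors of its
      decomposition; \<open>k = 0\<close> and the last \<open>k\<close> give back \<open>p\<close> and \<open>q\<close>.\<close>
  define us where "us p q = dec (segment w p q)" for p q
  define cut where "cut p q k = p + int (length (concat (take k (us p q))))" for p q k
  define D where "D = {cut p q k |p q k. consecutive C p q \<and> k \<le> length (us p q)}"
  have us: "us p q \<in> lists Z" "concat (us p q) = segment w p q" if "consecutive C p q" for p q
    using that fact dec by (auto simp: us_def factorization_def)
  have cut0: "cut p q 0 = p" for p q by (simp add: cut_def)
  have cutn: "cut p q (length (us p q)) = q" if "consecutive C p q" for p q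
    using that us [OF that] by (simp add: cut_def consecutive_def)
  have cut_Suc: "cut p q (Suc k) = cut p q k + int (length (us p q ! k))" if "k < length (us p q)" for p q k
    using that by (simp add: cut_def take_Suc_conv_app_nth)
  have ne: "us p q ! k \<noteq> []" if "consecutive C p q" "k < length (us p q)" for p q k
    using us(1) [OF that(1)] that(2) Z by (metis in_listsD nth_mem)
  have mono: "cut p q k \<le> cut p q k'" if "k \<le> k'" for p q k k'
  proof -
    have "take k' (us p q) = take k (us p q) @ take (k' - k) (drop k (us p q))"
      using that by (metis le_add_diff_inverse take_add)
    then show ?thesis by (simp add: cut_def)
  qed
  have CD: "C \<subseteq> D"
  proof
    fix p assume "p \<in> C"
    then obtain q where "consecutive C p q" using factorization_next [OF fact] by blast
    then have "cut p q 0 \<in> D" unfolding D_def by blast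
    then show "p \<in> D" by (simp add: cut0)
  qed
  have between: "\<exists>k\<le>length (us p q). r = cut p q k"
    if pq: "consecutive C p q" and r: "r \<in> D" "p \<le> r" "r \<le> q" for p q r
  proof -
    obtain a b k where ab: "consecutive C a b" "k \<le> length (us a b)" "r = cut a b k"
      using r(1) unfolding D_def by blast
    have rab: "a \<le> r" "r \<le> b"
      using mono [of 0 k a b] mono [OF ab(2), of a b] cut0 cutn [OF ab(1)] ab(3) by auto
    consider "a = p" | "a < p" | "a > p" by linarith
    then show ?thesis
    proof cases
      case 1
      then have "b = q" using pq ab(1) unfolding consecutive_def by (metis linorder_neqE)
      then show ?thesis using 1 ab by blast
    next
      case 2
      then have "r = p" using pq ab(1) rab r unfolding consecutive_def by force
      then show ?thesis using cut0 by (metis le0)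
    next
      case 3
      then have "r = q" using pq ab(1) rab r unfolding consecutive_def by force
      then show ?thesis using cutn [OF pq] by (metis le_refl)
    qed
  qed
  have "segment w p' q' \<in> Z" if D': "consecutive D p' q'" for p' q'
  proof -
    obtain p q where pq: "consecutive C p q" "p \<le> p'" "p' < q"
      using factorization_around [OF fact] .
    have in_D: "cut p q k \<in> D" if "k \<le> length (us p q)" for k
      using that pq(1) unfolding D_def by blast
    have "q \<in> D" using pq(1) CD by (auto simp: consecutive_def)
    then have "q' \<le> q" using D' pq(3) unfolding consecutive_def by force
    moreover have p'q': "p' \<in> D" "q' \<in> D" "p' < q'" using D' by (auto simp: consecutive_def)
    ultimately have "p \<le> q'" "p' \<le> q" using pq by auto
    obtain k where k: "k \<le> length (us p q)" "p' = cut p q k"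
      using between [OF pq(1) p'q'(1) pq(2) \<open>p' \<le> q\<close>] by blast
    obtain k' where k': "k' \<le> length (us p q)" "q' = cut p q k'"
      using between [OF pq(1) p'q'(2) \<open>p \<le> q'\<close> \<open>q' \<le> q\<close>] by blast
    have "p' < q'" using D' by (simp add: consecutive_def)
    then have "k < k'" using mono [of k' k p q] k k' by (cases "k < k'") auto
    then have kl: "k < length (us p q)" using k' by simp
    have "p' < cut p q (Suc k)" using cut_Suc [OF kl] ne [OF pq(1) kl] k by simp
    moreover have "cut p q (Suc k) \<le> q'" using mono \<open>k < k'\<close> k' by simp
    moreover have "cut p q (Suc k) \<in> D" using in_D kl by simp
    ultimately have q': "q' = cut p q (Suc k)"
      using D' unfolding consecutive_def by force
    have "us p q = take k (us p q) @ us p q ! k # drop (Suc k) (us p q)"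
      using kl by (rule id_take_nth_drop)
    then have "segment w p q =
        concat (take k (us p q)) @ us p q ! k @ concat (drop (Suc k) (us p q))"
      using us(2) [OF pq(1)] by (metis concat.simps(2) concat_append)
    from segment_infix [OF this] have "segment w p' q' = us p q ! k"
      using pq k(2) q' cut_Suc [OF kl] by (simp add: cut_def add.assoc)
    then show ?thesis using us(1) [OF pq(1)] kl by (metis in_listsD nth_mem)
  qed
  then have "factorization Z w D"
    using fact CD unfolding factorization_def by (metis subsetD)
  then show ?thesis ..
qed

text \<open>One set of words serves all of \<open>W\<close>, but each word of \<open>W\<close> may have cuts of its own.\<close>

definition coded_by :: "(int \<Rightarrow> 'a) set \<Rightarrow> nat \<Rightarrow> bool" where
  "coded_by W k \<longleftrightarrow>
     (\<exists>Z. finite Z \<and> [] \<notin> Z \<and> card Z \<le> k \<and> (\<forall>w\<in>W. \<exists>C. factorization Z w C))"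

definition coding_number :: "(int \<Rightarrow> 'a) set \<Rightarrow> nat" where
  "coding_number W = (LEAST k. coded_by W k)"

lemma coded_by_image:
  assumes "coded_by W k"
  shows "coded_by ((\<circ>) g ` W) k"
proof -
  obtain Z where Z: "finite Z" "[] \<notin> Z" "card Z \<le> k" "\<And>w. w \<in> W \<Longrightarrow> \<exists>C. factorization Z w C"
    using assms unfolding coded_by_def by blast
  have "card (map g ` Z) \<le> k" using Z(1,3) card_image_le [of Z "map g"] by simp
  moreover have "\<exists>C. factorization (map g ` Z) w C" if w: "w \<in> (\<circ>) g ` W" for w
    using w Z(4) factorization_map [of Z _ _ g] by blast
  moreover have "finite (map g ` Z)" "[] \<notin> map g ` Z" using Z(1,2) by auto
  ultimately show ?thesis unfolding coded_by_def by blast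
qed

text \<open>An optimal set \<open>Z\<close> for \<open>W\<close> is mapped to an optimal set for the image of \<open>W\<close>. Hence \<open>g\<close> is
injective on \<open>Z\<close>, and the image of \<open>Z\<close> is elementary, because factorizations can be refined.
Uniqueness of factorizations recovers the cuts from the image, and injectivity on \<open>Z\<close> the
blocks.\<close>

lemma injective_if_coding_number_eq:
  assumes coded: "coded_by W K"
    and eq: "coding_number ((\<circ>) g ` W) = coding_number W"
    and aper: "\<And>w d. w \<in> W \<Longrightarrow> d > 0 \<Longrightarrow> \<exists>i. g (w (i + d)) \<noteq> g (w i)"
  shows "inj_on ((\<circ>) g) W"
proof (rule inj_onI)
  fix w w' assume w: "w \<in> W" and w': "w' \<in> W" and same: "g \<circ> w = g \<circ> w'"
  have "coded_by W (coding_number W)"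
    unfolding coding_number_def using coded by (rule LeastI)
  then obtain Z where Z: "finite Z" "[] \<notin> Z" "card Z \<le> coding_number W"
    "\<And>w. w \<in> W \<Longrightarrow> \<exists>C. factorization Z w C"
    unfolding coded_by_def by blast
  let ?Z = "map g ` Z"
  have least: "coding_number W \<le> card Y"
    if Y: "finite Y" "[] \<notin> Y" "\<And>w. w \<in> W \<Longrightarrow> \<exists>C. factorization Y (g \<circ> w) C" for Y
  proof -
    have "coded_by ((\<circ>) g ` W) (card Y)" unfolding coded_by_def using Y by blast
    then have "coding_number ((\<circ>) g ` W) \<le> card Y"
      unfolding coding_number_def by (rule Least_le)
    then show ?thesis using eq by simp
  qed
  have gZ: "\<exists>C. factorization ?Z (g \<circ> w) C" if "w \<in> W" for w
    using Z(4) [OF that] factorization_map by blast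
  have fin: "finite ?Z" "[] \<notin> ?Z" using Z by auto
  have card: "card ?Z = card Z" "card ?Z = coding_number W"
    using least [OF fin gZ] card_image_le [OF Z(1), of "map g"] Z(3) by simp_all
  have inj: "inj_on (map g) Z" using card(1) Z(1) by (simp add: eq_card_imp_inj_on)
  have "elementary ?Z"
    unfolding elementary_def
  proof (intro allI impI)
    fix Y assume Y: "finite Y" "[] \<notin> Y" "?Z \<subseteq> concat ` lists Y"
    then have "\<exists>C. factorization Y (g \<circ> w) C" if "w \<in> W" for w
      using gZ [OF that] factorization_refine by blast
    then show "card ?Z \<le> card Y" using least [OF Y(1,2)] card(2) by simp
  qed
  obtain C where C: "factorization Z w C" using Z(4) w by blast
  obtain C' where C': "factorization Z w' C'" using Z(4) w' by blast
  have "factorization ?Z (g \<circ> w) C" "factorization ?Z (g \<circ> w) C'"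
    using factorization_map [OF C, of g] factorization_map [OF C', of g] same by simp_all
  then have "C = C'"
    using factorization_unique [OF fin \<open>elementary ?Z\<close>, of "g \<circ> w"] aper [OF w] by simp
  show "w = w'"
  proof
    fix i
    obtain p q where pq: "consecutive C p q" "p \<le> i" "i < q" using factorization_around [OF C] .
    have "segment w p q \<in> Z" "segment w' p q \<in> Z"
      using C C' pq \<open>C = C'\<close> by (auto simp: factorization_def)
    moreover have "map g (segment w p q) = map g (segment w' p q)"
      using same segment_map [of g w p q] segment_map [of g w' p q] by (simp add: comp_def)
    ultimately have "segment w p q = segment w' p q" using inj by (simp add: inj_on_eq_iff)
    then have "0 \<le> k \<and> k < q - p \<longrightarrow> w (p + k) = w' (p + k)" for k
      using pq segment_eq_iff [of p q p q w w'] by simp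
    from this [of "i - p"] show "w i = w' i" using pq by simp
  qed
qed

theorem row_determines_all_rows:
  fixes row :: "nat \<Rightarrow> 'p \<Rightarrow> int \<Rightarrow> 'a"
  assumes proj: "\<And>n x. x \<in> \<Omega> \<Longrightarrow> row n x = g n \<circ> row (Suc n) x"
    and coded: "\<And>n. coded_by (row n ` \<Omega>) K"
    and aper: "\<And>n x d. n \<ge> n0 \<Longrightarrow> x \<in> \<Omega> \<Longrightarrow> d > 0 \<Longrightarrow> \<exists>i. row n x (i + d) \<noteq> row n x i"
  shows "\<exists>N. \<forall>x\<in>\<Omega>. \<forall>y\<in>\<Omega>. row N x = row N y \<longrightarrow> (\<forall>n. row n x = row n y)"
proof -
  define \<rho> where "\<rho> n = coding_number (row n ` \<Omega>)" for n
  have img: "(\<circ>) (g n) ` row (Suc n) ` \<Omega> = row n ` \<Omega>" for n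
    unfolding image_image by (intro image_cong refl) (rule proj [symmetric])
  have "\<rho> n \<le> \<rho> (Suc n)" for n
  proof -
    have "coded_by (row (Suc n) ` \<Omega>) (\<rho> (Suc n))"
      unfolding \<rho>_def coding_number_def using coded by (rule LeastI)
    from coded_by_image [OF this, of "g n"] have "coded_by (row n ` \<Omega>) (\<rho> (Suc n))"
      unfolding img .
    then show ?thesis unfolding \<rho>_def [of n] coding_number_def by (rule Least_le)
  qed
  then have mono: "\<rho> m \<le> \<rho> n" if "m \<le> n" for m n
    using that by (rule lift_Suc_mono_le)
  have bound: "\<rho> n \<le> K" for n
    unfolding \<rho>_def coding_number_def using coded by (rule Least_le)
  have "\<exists>N. N \<ge> n0 \<and> (\<forall>n. n \<ge> n0 \<longrightarrow> \<rho> n \<le> \<rho> N)"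
    using ex_has_greatest_nat [of "\<lambda>n. n \<ge> n0" n0 \<rho> "Suc K"] bound by (auto simp: less_Suc_eq_le)
  then obtain N where N: "N \<ge> n0" "\<And>n. n \<ge> n0 \<Longrightarrow> \<rho> n \<le> \<rho> N" by blast
  have stable: "\<rho> n = \<rho> N" if "n \<ge> N" for n
    using mono [OF that] N(2) [of n] that N(1) by simp
  have next_row: "row (Suc n) x = row (Suc n) y"
    if "n \<ge> N" "x \<in> \<Omega>" "y \<in> \<Omega>" "row n x = row n y" for n x y
  proof -
    have "inj_on ((\<circ>) (g n)) (row (Suc n) ` \<Omega>)"
    proof (rule injective_if_coding_number_eq [OF coded])
      show "coding_number ((\<circ>) (g n) ` row (Suc n) ` \<Omega>) = coding_number (row (Suc n) ` \<Omega>)"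
        using stable [of n] stable [of "Suc n"] that(1) unfolding img \<rho>_def by simp
    next
      fix w and d :: int assume "w \<in> row (Suc n) ` \<Omega>" "d > 0"
      then obtain z where z: "z \<in> \<Omega>" "w = row (Suc n) z" by blast
      have "n0 \<le> n" using that(1) N(1) by simp
      from aper [OF this z(1) \<open>d > 0\<close>] show "\<exists>i. g n (w (i + d)) \<noteq> g n (w i)"
        using proj [OF z(1), of n] z(2) by simp
    qed
    then show ?thesis
    proof (rule inj_onD)
      show "g n \<circ> row (Suc n) x = g n \<circ> row (Suc n) y"
        using that(4) proj [OF that(2)] proj [OF that(3)] by metis
    qed (use that in auto)
  qed
  have "row n x = row n y" if "x \<in> \<Omega>" "y \<in> \<Omega>" "row N x = row N y" for x y n
  proof (cases "N \<le> n")
    case True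
    then show ?thesis
    proof (induction n rule: dec_induct)
      case base
      show ?case by (fact that(3))
    next
      case (step n)
      show ?case by (rule next_row) (fact step that)+
    qed
  next
    case False
    then have "n \<le> N" by simp
    then show ?thesis
    proof (induction n rule: inc_induct)
      case base
      show ?case by (fact that(3))
    next
      case (step n)
      then show ?case using proj [OF that(1), of n] proj [OF that(2), of n] by metis
    qed
  qed
  then show ?thesis by blast
qed

section \<open>Walks in GM-coverings\<close>

lemma set_vwalk_arcs:
  "set (vwalk_arcs c) = {(c ! j, c ! Suc j) |j. Suc j < length c}"
proof -
  have "vwalk_arcs c = map (\<lambda>j. (c ! j, c ! Suc j)) [0..<length c - 1]"
  proof (induction c rule: vwalk_arcs.induct)
    case (3 x y xs)
    then show ?case by (simp add: upt_conv_Cons map_Suc_upt [symmetric] del: upt_Suc)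
  qed auto
  then show ?thesis by (auto simp: less_diff_conv)
qed

lemma circuit_nth:
  assumes "circuit G c" "hd c = v"
  shows "0 < period c" "c ! 0 = v" "c ! period c = v"
    "0 < j \<Longrightarrow> j < period c \<Longrightarrow> c ! j \<noteq> v"
proof -
  have c: "2 \<le> length c" "hd c = last c" "distinct (butlast c)"
    using assms(1) by (auto simp: circuit_def)
  have ne: "c \<noteq> []" using c(1) by auto
  show "0 < period c" using c(1) by simp
  show c0: "c ! 0 = v" using ne assms(2) by (simp add: hd_conv_nth)
  show "c ! period c = v" using ne assms(2) c(2) by (simp add: last_conv_nth)
  show "c ! j \<noteq> v" if j: "0 < j" "j < period c"
  proof
    assume "c ! j = v"
    then have "butlast c ! j = butlast c ! 0" using j c0 by (simp add: nth_butlast)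
    then show False using c(3) j by (simp add: nth_eq_iff_index_eq)
  qed
qed

text \<open>
The circuits through a vertex other than the base vertex all continue in the same way until they
return to the base vertex, so a walk that has entered a circuit follows it to its end. The walk
therefore visits the base vertex with bounded gaps, and between two consecutive visits it runs
once through a circuit.
\<close>

theorem GM_walk_factorization:
  assumes GM: "GM_covering G \<phi> v l c" and m: "m > 0"
    and walk: "\<And>i. (w i, w (i + 1)) \<in> parcs (G m)"
  shows "factorization ((\<lambda>a. butlast (c m a)) ` {1..l m}) w {i. w i = v m}"
proof -
  let ?C = "{i. w i = v m}"
  have circ: "circuit (G m) (c m a)" "hd (c m a) = v m" if "a \<in> {1..l m}" for a
    using GM [unfolded GM_covering_def, THEN conjunct2, THEN spec, THEN mp, OF m] that by simp_all
  note nth = circuit_nth [OF circ]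
  have arcs: "(\<Union>a\<in>{1..l m}. set (vwalk_arcs (c m a))) = parcs (G m)"
    using GM m unfolding GM_covering_def by blast
  have merge: "\<exists>r. j + r = period (c m a) \<and> j' + r = period (c m b) \<and>
      (\<forall>k\<le>r. c m a ! (j + k) = c m b ! (j' + k))"
    if "a \<in> {1..l m}" "b \<in> {1..l m}" "j \<in> {1..period (c m a)}" "j' \<in> {1..period (c m b)}"
      "c m a ! j = c m b ! j'" for a b j j'
    using GM [unfolded GM_covering_def, THEN conjunct2, THEN spec, THEN mp, OF m] that by meson
  have arc: "\<exists>a\<in>{1..l m}. \<exists>j<period (c m a). w t = c m a ! j \<and> w (t + 1) = c m a ! Suc j" for t
  proof -
    have "(w t, w (t + 1)) \<in> (\<Union>a\<in>{1..l m}. set (vwalk_arcs (c m a)))"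
      using walk arcs by simp
    then obtain a j where "a \<in> {1..l m}" "Suc j < length (c m a)"
      "w t = c m a ! j" "w (t + 1) = c m a ! Suc j"
      by (auto simp: set_vwalk_arcs)
    moreover from this have "j < period (c m a)" by simp
    ultimately show ?thesis by blast
  qed
  \<comment> \<open>The walk may leave along an edge of another circuit \<open>b\<close>, but that circuit has merged with \<open>a\<close>.\<close>
  have follow: "w (t + int r) = c m a ! (k + r)"
    if a: "a \<in> {1..l m}" and "1 \<le> k" "w t = c m a ! k" "k + r \<le> period (c m a)" for t r a k
    using that(4)
  proof (induction r)
    case 0
    then show ?case using that by simp
  next
    case (Suc r)
    then have at: "w (t + int r) = c m a ! (k + r)" and kr: "k + r < period (c m a)" by simp_all
    obtain b j where b: "b \<in> {1..l m}" "j < period (c m b)"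
      "w (t + int r) = c m b ! j" "w (t + int r + 1) = c m b ! Suc j"
      using arc by blast
    have "j \<noteq> 0"
      using nth(2) [OF b(1) b(1)] nth(4) [OF a a _ kr] \<open>1 \<le> k\<close> at b(3) by (cases j) auto
    then obtain r' where r': "k + r + r' = period (c m a)" "j + r' = period (c m b)"
      and eq: "\<And>s. s \<le> r' \<Longrightarrow> c m a ! (k + r + s) = c m b ! (j + s)"
      using merge [OF a b(1), of "k + r" j] \<open>1 \<le> k\<close> kr b(2,3) at by auto
    have "1 \<le> r'" using r'(1) kr by simp
    then show ?case using eq [of 1] b(4) by (simp add: ac_simps)
  qed
  have "finite ((\<lambda>a. period (c m a)) ` {1..l m})" by simp
  then obtain L where L: "\<And>a. a \<in> {1..l m} \<Longrightarrow> period (c m a) \<le> L"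
    unfolding finite_nat_set_iff_bounded_le by blast
  have visit: "\<exists>s\<in>?C. t \<le> s \<and> s \<le> t + int L" for t
  proof -
    obtain a j where a: "a \<in> {1..l m}" "j < period (c m a)" "w t = c m a ! j"
      using arc by blast
    show ?thesis
    proof (cases "j = 0")
      case True
      then show ?thesis using a nth(2) [OF a(1) a(1)] by (intro bexI [of _ t]) auto
    next
      case False
      then have "w (t + int (period (c m a) - j)) = c m a ! period (c m a)"
        using follow [OF a(1), of j t "period (c m a) - j"] a by simp
      then show ?thesis using nth(3) [OF a(1) a(1)] L [OF a(1)]
        by (intro bexI [of _ "t + int (period (c m a) - j)"]) auto
    qed
  qed
  have "segment w p q \<in> (\<lambda>a. butlast (c m a)) ` {1..l m}" if pq: "consecutive ?C p q" for p q
  proof -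
    have wp: "w p = v m" "w q = v m" "p < q" using pq by (auto simp: consecutive_def)
    obtain a j where a: "a \<in> {1..l m}" "j < period (c m a)" "w p = c m a ! j"
      "w (p + 1) = c m a ! Suc j"
      using arc by blast
    have j: "j = 0" using nth(4) [OF a(1) a(1) _ a(2)] a(3) wp(1) by auto
    have walk_a: "w (p + int k) = c m a ! k" if "k \<le> period (c m a)" for k
    proof (cases k)
      case 0
      then show ?thesis using a j by simp
    next
      case (Suc k')
      then show ?thesis using follow [OF a(1), of 1 "p + 1" k'] a j that
        by (simp add: add.assoc)
    qed
    have "p + int (period (c m a)) \<in> ?C" using walk_a [of "period (c m a)"] nth(3) [OF a(1) a(1)] by simp
    then have "q \<le> p + int (period (c m a))"
      using pq nth(1) [OF a(1) a(1)] unfolding consecutive_def by force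
    moreover have "\<not> q < p + int (period (c m a))"
    proof
      assume "q < p + int (period (c m a))"
      then have "0 < nat (q - p)" "nat (q - p) < period (c m a)" using wp(3) by auto
      then have "c m a ! nat (q - p) \<noteq> v m" by (rule nth(4) [OF a(1) a(1)])
      then show False
        using walk_a [of "nat (q - p)"] \<open>nat (q - p) < period (c m a)\<close> wp by simp
    qed
    ultimately have q: "q = p + int (period (c m a))" by simp
    have "segment w p q = butlast (c m a)"
      using q walk_a by (intro nth_equalityI) (simp_all add: nth_butlast)
    then show ?thesis using a(1) by blast
  qed
  moreover have "\<exists>p\<in>?C. p \<le> i" for i using visit [of "i - int L"] by auto
  moreover have "\<exists>p\<in>?C. i < p" for i
  proof -
    obtain s where "s \<in> ?C" "i + 1 \<le> s" using visit [of "i + 1"] by blast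
    then show ?thesis by (intro bexI [of _ s]) auto
  qed
  ultimately show ?thesis unfolding factorization_def by blast
qed

lemma GM_rank_frequently:
  assumes "GM_rank l = enat K"
  shows "\<exists>m\<ge>n. l m \<le> K"
proof (rule ccontr)
  assume "\<not> ?thesis"
  then have "\<forall>m\<ge>n. enat (Suc K) \<le> enat (l m)" by (simp add: not_le Suc_le_eq) (meson not_le)
  then have "enat (Suc K) \<le> GM_rank l"
    unfolding GM_rank_def by (intro Liminf_bounded) (auto simp: eventually_sequentially)
  then show False using assms by simp
qed


section \<open>Expansiveness of natural extensions\<close>

lemma topspace_natural_extension:
  "x \<in> topspace (natural_extension X f) \<longleftrightarrow>
    (\<forall>i. x i \<in> topspace X) \<and> (\<forall>i. f (x i) = x (i + 1))"
  by (auto simp: natural_extension_def PiE_UNIV_domain)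

lemma continuous_map_natural_extension_iff:
  "continuous_map Y (natural_extension X f) F \<longleftrightarrow>
    (\<forall>i. continuous_map Y X (\<lambda>y. F y i)) \<and>
    (\<forall>y\<in>topspace Y. \<forall>i. f (F y i) = F y (i + 1))"
  unfolding natural_extension_def continuous_map_in_subtopology continuous_map_componentwise_UNIV
  by auto

lemma continuous_map_coordinate:
  "continuous_map (natural_extension X f) X (\<lambda>x. x i)"
  unfolding natural_extension_def
  by (intro continuous_map_from_subtopology continuous_map_product_projection) simp

lemma compact_natural_extension:
  assumes "compact_space X" "Hausdorff_space X" "continuous_map X X f"
  shows "compact_space (natural_extension X f)"
proof -
  let ?P = "product_topology (\<lambda>_::int. X) UNIV"
  let ?S = "\<lambda>i. {x \<in> topspace ?P. f (x i) = x (i + 1)}"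
  have "closedin ?P (?S i)" for i
  proof (rule closedin_continuous_maps_eq [OF assms(2)])
    show "continuous_map ?P X (\<lambda>x. f (x i))"
      using continuous_map_compose [OF continuous_map_product_projection [of i UNIV "\<lambda>_. X"] assms(3)]
      by (simp add: comp_def)
    show "continuous_map ?P X (\<lambda>x. x (i + 1))"
      by (intro continuous_map_product_projection) simp
  qed
  then have "closedin ?P (\<Inter>i. ?S i)" by blast
  moreover have "compact_space ?P" using assms(1) by (simp add: compact_space_product_topology)
  ultimately have "compactin ?P (\<Inter>i. ?S i)" by (simp add: closedin_compact_space)
  moreover have "natural_extension X f = subtopology ?P (\<Inter>i. ?S i)"
    unfolding natural_extension_def
    by (subst (1 2) subtopology_restrict [symmetric]) (rule arg_cong [of _ _ "subtopology ?P"], auto)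
  ultimately show ?thesis by (simp add: compact_space_subtopology)
qed

lemma metrizable_natural_extension:
  assumes "metrizable_space X"
  shows "metrizable_space (natural_extension X f)"
  unfolding natural_extension_def
  using assms by (intro metrizable_space_subtopology) (simp add: metrizable_space_product_topology)

lemma shift_in_natural_extension:
  assumes "x \<in> topspace (natural_extension X f)"
  shows "(\<lambda>i. x (i + k)) \<in> topspace (natural_extension X f)"
  using assms unfolding topspace_natural_extension by (metis add.assoc add.commute)

lemma homeomorphic_map_shift:
  "homeomorphic_map (natural_extension X f) (natural_extension X f) shift"
proof -
  have cont: "continuous_map (natural_extension X f) (natural_extension X f) (\<lambda>x i. x (i + k))" for k
    unfolding continuous_map_natural_extension_iff
  proof (intro conjI allI ballI)
    fix i and x :: "int \<Rightarrow> 'a" assume "x \<in> topspace (natural_extension X f)"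
    from shift_in_natural_extension [OF this, of k]
    show "f (x (i + k)) = x (i + 1 + k)" unfolding topspace_natural_extension by blast
  qed (rule continuous_map_coordinate)
  have "homeomorphic_maps (natural_extension X f) (natural_extension X f)
      shift (\<lambda>x i. x (i + (- 1)))"
    using cont [of 1] cont [of "- 1"] by (simp add: homeomorphic_maps_def Defs.shift_def [abs_def])
  then show ?thesis unfolding homeomorphic_map_maps by blast
qed

lemma int_iterate_shift:
  assumes "x \<in> topspace (natural_extension X f)"
  shows "int_iterate (natural_extension X f) shift i x = (\<lambda>j. x (j + i))"
proof -
  let ?N = "topspace (natural_extension X f)"
  have fwd: "(shift ^^ n) y = (\<lambda>j. y (j + int n))" for n and y :: "int \<Rightarrow> 'a"
    by (induction n) (auto simp: Defs.shift_def ac_simps)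
  have inv: "inv_into ?N shift y = (\<lambda>j. y (j - 1))" if "y \<in> ?N" for y
  proof (rule inv_into_f_eq)
    show "inj_on shift ?N"
      using homeomorphic_map_shift [of X f] by (rule homeomorphic_imp_injective_map)
    show "(\<lambda>j. y (j - 1)) \<in> ?N" using shift_in_natural_extension [OF that, of "- 1"] by simp
    show "shift (\<lambda>j. y (j - 1)) = y" by (simp add: Defs.shift_def)
  qed
  have bwd: "(inv_into ?N shift ^^ n) x = (\<lambda>j. x (j - int n))" for n
  proof (induction n)
    case (Suc n)
    have "(\<lambda>j. x (j - int n)) \<in> ?N"
      using shift_in_natural_extension [OF assms, of "- int n"] by simp
    from inv [OF this] Suc show ?case by (simp add: algebra_simps)
  qed simp
  show ?thesis by (simp add: int_iterate_def fwd bwd)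
qed

text \<open>By compactness finitely many balls suffice whose doubles lie in level sets of \<open>F\<close>; the least
of their radii is a suitable \<open>\<epsilon>\<close>.\<close>

lemma locally_constant_uniform:
  assumes "Metric_space M d" and compact: "compact_space (Metric_space.mtopology M d)"
    and cont: "continuous_map (Metric_space.mtopology M d) (discrete_topology U) F"
  shows "\<exists>\<epsilon>>0. \<forall>x\<in>M. \<forall>y\<in>M. d x y \<le> \<epsilon> \<longrightarrow> F x = F y"
proof -
  interpret Metric_space M d by fact
  have "\<exists>r>0. mball x (2 * r) \<subseteq> {y \<in> M. F y = F x}" if x: "x \<in> M" for x
  proof -
    have "F x \<in> U" using cont x by (auto simp: continuous_map_def)
    then have "openin mtopology {y \<in> M. F y = F x}"
      using openin_continuous_map_preimage [OF cont, of "{F x}"] by simp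
    then obtain r where "r > 0" "mball x r \<subseteq> {y \<in> M. F y = F x}"
      using x unfolding openin_mtopology by blast
    then show ?thesis by (intro exI [of _ "r / 2"]) simp
  qed
  then obtain r where r: "\<And>x. x \<in> M \<Longrightarrow> r x > 0"
    "\<And>x. x \<in> M \<Longrightarrow> mball x (2 * r x) \<subseteq> {y \<in> M. F y = F x}" by metis
  have "M \<subseteq> \<Union> ((\<lambda>x. mball x (r x)) ` M)" using r(1) by auto
  moreover have "\<And>B. B \<in> (\<lambda>x. mball x (r x)) ` M \<Longrightarrow> openin mtopology B" by auto
  moreover have "compactin mtopology M" using compact by (simp add: compact_space_def)
  ultimately obtain \<F> where \<F>: "finite \<F>" "\<F> \<subseteq> (\<lambda>x. mball x (r x)) ` M" "M \<subseteq> \<Union> \<F>"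
    unfolding compactin_def by meson
  obtain T where "T \<subseteq> M" "finite T" "\<F> = (\<lambda>x. mball x (r x)) ` T"
    using finite_subset_image [OF \<F>(1,2)] by blast
  with \<F>(3) have T: "finite T" "T \<subseteq> M" "M \<subseteq> (\<Union>x\<in>T. mball x (r x))"
    by blast+
  define \<epsilon> where "\<epsilon> = Min (insert 1 (r ` T))"
  have \<epsilon>: "\<epsilon> > 0" "\<And>x. x \<in> T \<Longrightarrow> \<epsilon> \<le> r x"
    using T(1,2) r(1) unfolding \<epsilon>_def by (auto simp: Min_gr_iff)
  have "F y = F z" if yz: "y \<in> M" "z \<in> M" "d y z \<le> \<epsilon>" for y z
  proof -
    obtain x where x: "x \<in> T" "d x y < r x" "x \<in> M" using yz(1) T by fastforce
    have "d x z \<le> d x y + d y z" using triangle yz x by blast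
    then have "d x z < 2 * r x" using yz(3) \<epsilon>(2) [OF x(1)] x(2) by simp
    then have "y \<in> mball x (2 * r x)" "z \<in> mball x (2 * r x)" using x yz r(1) [OF x(3)] by auto
    from this [THEN subsetD [OF r(2) [OF x(3)]]] show ?thesis by simp
  qed
  then show ?thesis using \<epsilon>(1) by blast
qed

text \<open>Points with different codes at coordinate \<open>i\<close> have, after \<open>i\<close> shifts, different codes at
coordinate \<open>0\<close>; since the code at \<open>0\<close> is locally constant, they are then more than \<open>\<epsilon>\<close> apart.\<close>

theorem expansive_if_coding_injective:
  assumes X: "compact_space X" "metrizable_space X" "continuous_map X X f"
    and cont: "continuous_map X (discrete_topology U) p"
    and inj: "\<And>x y. x \<in> topspace (natural_extension X f) \<Longrightarrow> y \<in> topspace (natural_extension X f) \<Longrightarrow>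
      (\<And>i. p (x i) = p (y i)) \<Longrightarrow> x = y"
  shows "expansive (natural_extension X f) shift"
proof -
  let ?N = "natural_extension X f"
  have compact: "compact_space ?N"
    using X metrizable_imp_Hausdorff_space compact_natural_extension by blast
  obtain M d where d: "Metric_space M d" "?N = Metric_space.mtopology M d"
    using metrizable_natural_extension [OF X(2)] unfolding metrizable_space_def by blast
  then have M: "M = topspace ?N" by (simp add: Metric_space.topspace_mtopology)
  have "continuous_map ?N (discrete_topology U) (\<lambda>x. p (x 0))"
    using continuous_map_compose [OF continuous_map_coordinate cont] by (simp add: comp_def)
  then obtain \<epsilon> where \<epsilon>: "\<epsilon> > 0"
    "\<And>x y. x \<in> M \<Longrightarrow> y \<in> M \<Longrightarrow> d x y \<le> \<epsilon> \<Longrightarrow> p (x 0) = p (y 0)"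
    using locally_constant_uniform [OF d(1)] compact d(2) by metis
  have "\<exists>i. d (int_iterate ?N shift i x) (int_iterate ?N shift i y) > \<epsilon>"
    if xy: "x \<in> topspace ?N" "y \<in> topspace ?N" "x \<noteq> y" for x y
  proof -
    obtain i where i: "p (x i) \<noteq> p (y i)" using inj xy by blast
    let ?x = "\<lambda>j. x (j + i)" and ?y = "\<lambda>j. y (j + i)"
    have "?x \<in> M" "?y \<in> M" using xy M shift_in_natural_extension by auto
    then have "\<not> d ?x ?y \<le> \<epsilon>" using \<epsilon>(2) [of ?x ?y] i by auto
    then show ?thesis using xy by (intro exI [of _ i]) (simp add: int_iterate_shift)
  qed
  then show ?thesis
    unfolding expansive_def using compact homeomorphic_map_shift d M \<epsilon>(1) by metis
qed

section \<open>Systems with periodic levels have rank one\<close>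

text \<open>Each level \<open>n\<close> of a coding \<open>\<pi>\<close> of the system is assumed to be periodic along a single orbit. By
minimality it is then periodic on the whole space, and the system is the inverse limit of the
cyclic rotations by which it acts on its levels.\<close>

locale periodic_levels =
  fixes X :: "'a topology" and f :: "'a \<Rightarrow> 'a" and \<pi> :: "'a \<Rightarrow> nat \<Rightarrow> 'b" and g :: "nat \<Rightarrow> 'b \<Rightarrow> 'b"
  assumes system: "zero_dim_system X f" and min: "minimal X f" and nonempty: "topspace X \<noteq> {}"
    and cont: "\<And>n. continuous_map X (discrete_topology UNIV) (\<lambda>x. \<pi> x n)"
    and inj: "\<And>x y. x \<in> topspace X \<Longrightarrow> y \<in> topspace X \<Longrightarrow> (\<And>n. \<pi> x n = \<pi> y n) \<Longrightarrow> x = y"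
    and proj: "\<And>x n. x \<in> topspace X \<Longrightarrow> \<pi> x n = g n (\<pi> x (Suc n))"
    and level0: "\<And>x y. x \<in> topspace X \<Longrightarrow> y \<in> topspace X \<Longrightarrow> \<pi> x 0 = \<pi> y 0"
    and periodic: "\<And>n. \<exists>x\<in>topspace X. \<exists>d>0. \<forall>j. \<pi> ((f ^^ (j + d)) x) n = \<pi> ((f ^^ j) x) n"
begin

definition is_period :: "nat \<Rightarrow> nat \<Rightarrow> bool" where
  "is_period n d \<longleftrightarrow> (\<forall>x\<in>topspace X. \<pi> ((f ^^ d) x) n = \<pi> x n)"

definition per :: "nat \<Rightarrow> nat" where
  "per n = (LEAST d. d > 0 \<and> is_period n d)"

lemma iter_in [simp]: "x \<in> topspace X \<Longrightarrow> (f ^^ k) x \<in> topspace X"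
  using system by (induction k) (auto simp: zero_dim_system_def)

lemma iter_add: "(f ^^ j) ((f ^^ k) x) = (f ^^ (j + k)) x"
  by (simp add: funpow_add)

lemma cont_iter: "continuous_map X X (f ^^ k)"
proof (induction k)
  case (Suc k)
  then show ?case
    using system continuous_map_compose [of X X "f ^^ k" X f] by (simp add: zero_dim_system_def comp_def)
qed (simp add: id_def)

lemma open_level: "openin X {x \<in> topspace X. \<pi> ((f ^^ k) x) n = a}"
proof -
  have "continuous_map X (discrete_topology UNIV) (\<lambda>x. \<pi> ((f ^^ k) x) n)"
    using continuous_map_compose [OF cont_iter cont] by (simp add: comp_def)
  from openin_continuous_map_preimage [OF this, of "{a}"] show ?thesis by simp
qed

lemma open_window:
  "openin X {x \<in> topspace X. \<forall>j<L. \<pi> ((f ^^ j) x) n = a j}"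
proof -
  have "openin X ((\<Inter>j\<in>{..<L}. {x \<in> topspace X. \<pi> ((f ^^ j) x) n = a j}) \<inter> topspace X)"
    using open_level by (intro openin_INT) auto
  moreover have "(\<Inter>j\<in>{..<L}. {x \<in> topspace X. \<pi> ((f ^^ j) x) n = a j}) \<inter> topspace X =
      {x \<in> topspace X. \<forall>j<L. \<pi> ((f ^^ j) x) n = a j}" by auto
  ultimately show ?thesis by simp
qed

lemma orbit_meets:
  assumes "x \<in> topspace X" "openin X U" "z \<in> U"
  shows "\<exists>k. (f ^^ k) x \<in> U"
proof -
  have "z \<in> X closure_of (range (\<lambda>n. (f ^^ n) x))"
    using min assms openin_subset unfolding minimal_def by blast
  then show ?thesis using assms(2,3) unfolding in_closure_of by blast
qed

text \<open>Where the code at level \<open>n\<close> changes after \<open>d\<close> steps, it changes on a whole open set, which every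
orbit meets.\<close>

lemma period_spreads:
  assumes x: "x \<in> topspace X" and d: "\<And>j. \<pi> ((f ^^ (j + d)) x) n = \<pi> ((f ^^ j) x) n"
  shows "is_period n d"
  unfolding is_period_def
proof
  fix z assume z: "z \<in> topspace X"
  let ?U = "{y \<in> topspace X. \<pi> ((f ^^ d) y) n = \<pi> ((f ^^ d) z) n} \<inter>
            {y \<in> topspace X. \<pi> ((f ^^ 0) y) n = \<pi> ((f ^^ 0) z) n}"
  have "openin X ?U" using open_level by (intro openin_Int) blast+
  moreover have "z \<in> ?U" using z by simp
  ultimately obtain k where "(f ^^ k) x \<in> ?U" using orbit_meets [OF x] by blast
  then show "\<pi> ((f ^^ d) z) n = \<pi> z n"
    using d [of k] by (simp add: iter_add add.commute)
qed

lemma per: "per n > 0" "is_period n (per n)"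
proof -
  have "\<exists>d. d > 0 \<and> is_period n d" using periodic [of n] period_spreads by blast
  then have "per n > 0 \<and> is_period n (per n)" unfolding per_def by (rule LeastI_ex)
  then show "per n > 0" "is_period n (per n)" by auto
qed

lemma is_period_mult:
  assumes "is_period n d" "x \<in> topspace X"
  shows "\<pi> ((f ^^ (d * q + r)) x) n = \<pi> ((f ^^ r) x) n"
proof (induction q)
  case (Suc q)
  have "\<pi> ((f ^^ (d * Suc q + r)) x) n = \<pi> ((f ^^ d) ((f ^^ (d * q + r)) x)) n"
    by (simp add: iter_add add.assoc)
  also have "\<dots> = \<pi> ((f ^^ (d * q + r)) x) n"
    using assms unfolding is_period_def by simp
  finally show ?case using Suc by simp
qed simp

lemma iter_mod: "x \<in> topspace X \<Longrightarrow> \<pi> ((f ^^ (k mod per n)) x) n = \<pi> ((f ^^ k) x) n"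
  using is_period_mult [OF per(2), of x n "k div per n" "k mod per n"] by simp

lemma per_dvd:
  assumes "is_period n d"
  shows "per n dvd d"
proof (rule ccontr)
  assume "\<not> per n dvd d"
  then have "0 < d mod per n" by (simp add: dvd_eq_mod_eq_0)
  moreover have "is_period n (d mod per n)"
    using assms unfolding is_period_def by (simp add: iter_mod)
  ultimately have "per n \<le> d mod per n" unfolding per_def [of n] by (intro Least_le) simp
  then show False using per(1) [of n] by (meson mod_less_divisor not_less)
qed

lemma per_Suc: "per n dvd per (Suc n)"
proof (rule per_dvd)
  show "is_period n (per (Suc n))"
    using per(2) [of "Suc n"] proj [of _ n] unfolding is_period_def by simp
qed

lemma per_0: "per 0 = 1"
proof -
  have "is_period 0 1" unfolding is_period_def by (intro ballI level0 iter_in)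
  from per_dvd [OF this] show ?thesis by simp
qed

definition base :: 'a where "base = (SOME x. x \<in> topspace X)"

lemma base_in [simp]: "base \<in> topspace X"
  unfolding base_def using nonempty by (simp add: some_in_eq)

text \<open>Seen at level \<open>n\<close>, the orbit of \<open>z\<close> is the orbit of the base point from step \<open>k\<close> on. The
residue of \<open>k\<close> modulo the least period is the phase of \<open>z\<close>, and the phases conjugate the system to the
inverse limit of the cycles.\<close>

definition tracks :: "nat \<Rightarrow> 'a \<Rightarrow> nat \<Rightarrow> bool" where
  "tracks n z k \<longleftrightarrow> (\<forall>j. \<pi> ((f ^^ j) z) n = \<pi> ((f ^^ (j + k)) base) n)"

definition phase :: "'a \<Rightarrow> nat \<Rightarrow> nat" where
  "phase z n = (SOME k. k < per n \<and> tracks n z k)"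

lemma tracks_mod:
  assumes "tracks n z k"
  shows "tracks n z (k mod per n)"
  unfolding tracks_def
proof
  fix j
  have "\<pi> ((f ^^ (j + k mod per n)) base) n = \<pi> ((f ^^ (j + k)) base) n"
    using iter_mod [OF base_in, of "j + k mod per n" n] iter_mod [OF base_in, of "j + k" n]
    by (simp add: mod_add_right_eq)
  then show "\<pi> ((f ^^ j) z) n = \<pi> ((f ^^ (j + k mod per n)) base) n"
    using assms unfolding tracks_def by simp
qed

lemma tracks_window:
  assumes z: "z \<in> topspace X" and w: "\<And>j. j < per n \<Longrightarrow> \<pi> ((f ^^ j) z) n = \<pi> ((f ^^ (j + k)) base) n"
  shows "tracks n z k"
  unfolding tracks_def
proof
  fix j
  have "\<pi> ((f ^^ j) z) n = \<pi> ((f ^^ (j mod per n)) z) n"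
    using z by (simp add: iter_mod)
  also have "\<dots> = \<pi> ((f ^^ (j mod per n)) ((f ^^ k) base)) n"
    using w per(1) by (simp add: iter_add)
  also have "\<dots> = \<pi> ((f ^^ (j + k)) base) n"
    by (simp add: iter_mod) (simp add: iter_add)
  finally show "\<pi> ((f ^^ j) z) n = \<pi> ((f ^^ (j + k)) base) n" .
qed

text \<open>A window of one least period determines the code at level \<open>n\<close> of a whole orbit, and the orbit of the base
point enters the open set given by the window of \<open>z\<close>.\<close>

lemma tracks_exists:
  assumes z: "z \<in> topspace X"
  shows "\<exists>k. tracks n z k"
proof -
  let ?U = "{x \<in> topspace X. \<forall>j<per n. \<pi> ((f ^^ j) x) n = \<pi> ((f ^^ j) z) n}"
  have "z \<in> ?U" using z by simp
  from orbit_meets [OF base_in open_window this] obtain k where "(f ^^ k) base \<in> ?U" by blast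
  then have "tracks n z k" using z by (intro tracks_window) (auto simp: iter_add)
  then show ?thesis ..
qed

lemma phase: "z \<in> topspace X \<Longrightarrow> phase z n < per n" "z \<in> topspace X \<Longrightarrow> tracks n z (phase z n)"
proof -
  assume z: "z \<in> topspace X"
  obtain k where "tracks n z k" using tracks_exists [OF z] by blast
  then have "k mod per n < per n \<and> tracks n z (k mod per n)"
    using tracks_mod per(1) by simp
  then have "phase z n < per n \<and> tracks n z (phase z n)"
    unfolding phase_def by (rule someI)
  then show "phase z n < per n" "tracks n z (phase z n)" by auto
qed

text \<open>Two such \<open>k\<close> differ by a period of an orbit, hence by a multiple of the least period.\<close>

lemma tracks_unique:
  assumes "tracks n z k" "tracks n z k'"
  shows "k mod per n = k' mod per n"
  using assms
proof (induction k k' rule: linorder_wlog)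
  case (le k k')
  have "\<pi> ((f ^^ (j + (k' - k))) ((f ^^ k) base)) n = \<pi> ((f ^^ j) ((f ^^ k) base)) n" for j
    using le unfolding tracks_def by (simp add: iter_add)
  then have "is_period n (k' - k)" by (intro period_spreads [of "(f ^^ k) base"]) simp_all
  then show ?case using per_dvd mod_eq_dvd_iff_nat [OF le(1)] by metis
qed auto

lemma phase_eqI:
  assumes "z \<in> topspace X" "tracks n z k"
  shows "phase z n = k mod per n"
  using tracks_unique [OF phase(2) assms(2)] phase(1) assms(1) by simp

lemma phase_f:
  assumes z: "z \<in> topspace X"
  shows "phase (f z) n = (phase z n + 1) mod per n"
proof (rule phase_eqI)
  show "f z \<in> topspace X" using iter_in [OF z, of 1] by simp
  have "\<pi> ((f ^^ j) (f z)) n = \<pi> ((f ^^ (j + (phase z n + 1))) base) n" for j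
    using phase(2) [OF z, of n, unfolded tracks_def, THEN spec, of "Suc j"]
    by (simp add: funpow_swap1)
  then show "tracks n (f z) (phase z n + 1)" unfolding tracks_def by blast
qed

lemma phase_proj:
  assumes z: "z \<in> topspace X"
  shows "phase z n = phase z (Suc n) mod per n"
proof (rule phase_eqI [OF z])
  show "tracks n z (phase z (Suc n))"
    using phase(2) [OF z, of "Suc n"] z proj [of _ n] unfolding tracks_def by simp
qed

lemma phase_base: "phase ((f ^^ k) base) n = k mod per n"
  by (rule phase_eqI) (simp_all add: tracks_def iter_add)

lemma open_phase: "openin X {z \<in> topspace X. phase z n = k}"
proof (subst openin_subopen, intro ballI)
  fix z assume "z \<in> {z \<in> topspace X. phase z n = k}"
  then have z: "z \<in> topspace X" "phase z n = k" by auto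
  let ?U = "{x \<in> topspace X. \<forall>j<per n. \<pi> ((f ^^ j) x) n = \<pi> ((f ^^ (j + k)) base) n}"
  have "z \<in> ?U" using phase(2) [OF z(1), of n] z unfolding tracks_def by simp
  moreover have "?U \<subseteq> {z \<in> topspace X. phase z n = k}"
  proof
    fix x assume "x \<in> ?U"
    then have "x \<in> topspace X" "tracks n x k" by (auto intro: tracks_window)
    moreover have "k < per n" using phase(1) [OF z(1)] z(2) by blast
    ultimately show "x \<in> {z \<in> topspace X. phase z n = k}"
      using phase_eqI by simp
  qed
  moreover have "openin X ?U" by (rule open_window)
  ultimately show "\<exists>T. openin X T \<and> z \<in> T \<and> T \<subseteq> {z \<in> topspace X. phase z n = k}"
    by (intro exI [of _ ?U]) simp
qed

text \<open>The covering of rank one: the graph at level \<open>n\<close> is a cycle through the residues modulo the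
least period, with a loop if this period is \<open>1\<close>.\<close>

definition cycle_graph :: "nat \<Rightarrow> nat pair_pre_digraph" where
  "cycle_graph n = \<lparr>pverts = {..<per n}, parcs = {(u, Suc u mod per n) |u. u < per n}\<rparr>"

definition residue :: "nat \<Rightarrow> nat \<Rightarrow> nat" where
  "residue n u = u mod per n"

definition cycle_walk :: "nat \<Rightarrow> nat list" where
  "cycle_walk n = map (\<lambda>j. j mod per n) [0..<Suc (per n)]"

lemma length_cycle_walk [simp]: "length (cycle_walk n) = Suc (per n)"
  by (simp add: cycle_walk_def)

lemma nth_cycle_walk: "j \<le> per n \<Longrightarrow> cycle_walk n ! j = j mod per n"
  unfolding cycle_walk_def by (subst nth_map) (simp_all del: upt_Suc)

lemma cycle_walk_arcs: "set (vwalk_arcs (cycle_walk n)) = parcs (cycle_graph n)"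
proof -
  have "(cycle_walk n ! j, cycle_walk n ! Suc j) = (j, Suc j mod per n)" if "j < per n" for j
    using that by (simp add: nth_cycle_walk)
  then have "(\<lambda>j. (cycle_walk n ! j, cycle_walk n ! Suc j)) ` {..<per n} =
      (\<lambda>j. (j, Suc j mod per n)) ` {..<per n}"
    by (intro image_cong) auto
  then show ?thesis unfolding set_vwalk_arcs cycle_graph_def by (simp add: setcompr_eq_image lessThan_def)
qed

lemma covering_cycle_graph: "covering cycle_graph residue"
  unfolding covering_def
proof (intro conjI allI)
  show "\<exists>v. cycle_graph 0 = \<lparr>pverts = {v}, parcs = {(v, v)}\<rparr>"
    by (intro exI [of _ 0]) (auto simp: cycle_graph_def per_0)
next
  fix n
  have fin: "pair_fin_digraph (cycle_graph n)"
  proof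
    have "parcs (cycle_graph n) = (\<lambda>u. (u, Suc u mod per n)) ` {..<per n}"
      unfolding cycle_graph_def by auto
    then show "finite (parcs (cycle_graph n))" by simp
  qed (use per(1) in \<open>auto simp: cycle_graph_def\<close>)
  have "\<exists>u. (u, v) \<in> parcs (cycle_graph n)" if "v < per n" for v
  proof (cases v)
    case 0
    then show ?thesis using per(1) [of n]
      by (intro exI [of _ "per n - 1"]) (simp add: cycle_graph_def)
  next
    case (Suc u)
    then show ?thesis using that by (intro exI [of _ u]) (simp add: cycle_graph_def)
  qed
  then show "covering_graph (cycle_graph n)"
    unfolding covering_graph_def using fin by (auto simp: cycle_graph_def)
next
  fix n
  have residue_Suc: "Suc u mod per (Suc n) mod per n = Suc (u mod per n) mod per n" for u
    using per_Suc by (simp add: mod_mod_cancel mod_Suc_eq)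
  have le: "per n \<le> per (Suc n)" using per_Suc per(1) by (simp add: dvd_imp_le)
  have "map_prod (residue n) (residue n) ` parcs (cycle_graph (Suc n)) = parcs (cycle_graph n)"
  proof (intro equalityI subsetI)
    fix e assume "e \<in> map_prod (residue n) (residue n) ` parcs (cycle_graph (Suc n))"
    then obtain u where "e = (u mod per n, Suc (u mod per n) mod per n)"
      by (auto simp: cycle_graph_def residue_def residue_Suc)
    then show "e \<in> parcs (cycle_graph n)" using per(1) by (auto simp: cycle_graph_def)
  next
    fix e assume "e \<in> parcs (cycle_graph n)"
    then obtain u where u: "u < per n" "e = (u, Suc u mod per n)" by (auto simp: cycle_graph_def)
    have "e = map_prod (residue n) (residue n) (u, Suc u mod per (Suc n))"
      using u by (simp add: residue_def residue_Suc)
    moreover have "(u, Suc u mod per (Suc n)) \<in> parcs (cycle_graph (Suc n))"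
      using u le by (auto simp: cycle_graph_def)
    ultimately show "e \<in> map_prod (residue n) (residue n) ` parcs (cycle_graph (Suc n))" by blast
  qed
  moreover from this have "graph_hom (cycle_graph (Suc n)) (cycle_graph n) (residue n)"
    unfolding graph_hom_def using per(1) by (auto simp: cycle_graph_def residue_def residue_Suc)
  moreover have "plus_directional (cycle_graph (Suc n)) (residue n)"
    unfolding plus_directional_def by (auto simp: cycle_graph_def)
  ultimately show "graph_cover (cycle_graph (Suc n)) (cycle_graph n) (residue n)"
    unfolding graph_cover_def edge_surjective_def by blast
qed

lemma circuit_cycle_walk: "circuit (cycle_graph n) (cycle_walk n)" "hd (cycle_walk n) = 0"
proof -
  have ne: "cycle_walk n \<noteq> []" by (metis length_cycle_walk list.size(3) nat.distinct(1))
  show hd0: "hd (cycle_walk n) = 0" using ne by (simp add: hd_conv_nth nth_cycle_walk)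
  have "last (cycle_walk n) = 0" using ne by (simp add: last_conv_nth nth_cycle_walk)
  moreover have "butlast (cycle_walk n) = [0..<per n]"
    by (intro nth_equalityI) (simp_all add: nth_butlast nth_cycle_walk)
  moreover have "set (cycle_walk n) \<subseteq> pverts (cycle_graph n)"
    using per(1) by (auto simp: cycle_walk_def cycle_graph_def)
  then have "vwalk (cycle_walk n) (with_proj (cycle_graph n))"
    using ne cycle_walk_arcs [of n] unfolding vwalk_def by simp
  ultimately show "circuit (cycle_graph n) (cycle_walk n)"
    unfolding circuit_def using hd0 per(1) [of n] by simp
qed

lemma GM_covering_cycle_graph: "GM_covering cycle_graph residue (\<lambda>_. 0) (\<lambda>_. 1) (\<lambda>n _. cycle_walk n)"
proof -
  have merge: "\<exists>r. j + r = period (cycle_walk n) \<and> j' + r = period (cycle_walk n) \<and>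
      (\<forall>k\<le>r. cycle_walk n ! (j + k) = cycle_walk n ! (j' + k))"
    if "j \<in> {1..period (cycle_walk n)}" "j' \<in> {1..period (cycle_walk n)}"
      "cycle_walk n ! j = cycle_walk n ! j'" for n j j'
  proof -
    have "j mod per n = j' mod per n" using that by (simp add: nth_cycle_walk)
    then have "j = j'" using that by (cases "j = per n"; cases "j' = per n") auto
    then show ?thesis using that by (intro exI [of _ "per n - j"]) auto
  qed
  have one: "residue n (cycle_walk (Suc n) ! 1) = cycle_walk n ! 1" for n
  proof -
    have "1 \<le> per n" "1 \<le> per (Suc n)" using per(1) by (simp_all add: Suc_le_eq)
    then show ?thesis using per_Suc [of n] by (simp add: nth_cycle_walk residue_def mod_mod_cancel del: One_nat_def)
  qed
  have base: "0 \<in> pverts (cycle_graph n)" for n using per(1) by (simp add: cycle_graph_def)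
  show ?thesis
    unfolding GM_covering_def
    using covering_cycle_graph base circuit_cycle_walk cycle_walk_arcs merge one by (simp add: residue_def)
qed

lemma GM_simple_cycle_graph: "GM_simple cycle_graph residue (\<lambda>_. 1) (\<lambda>n _. cycle_walk n)"
  unfolding GM_simple_def
proof (intro allI impI)
  fix n :: nat
  have comp: "cover_comp residue (Suc n) n = residue n" by (cases n) auto
  have "vwalk_arcs (map h xs) = map (map_prod h h) (vwalk_arcs xs)" for h :: "nat \<Rightarrow> nat" and xs
    by (induction xs rule: vwalk_arcs.induct) auto
  then have "set (vwalk_arcs (map (cover_comp residue (Suc n) n) (cycle_walk (Suc n)))) =
      map_prod (residue n) (residue n) ` parcs (cycle_graph (Suc n))"
    unfolding comp by (simp add: cycle_walk_arcs)
  also have "\<dots> = parcs (cycle_graph n)"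
    using covering_cycle_graph unfolding covering_def graph_cover_def edge_surjective_def by blast
  finally show "\<exists>m>n. \<forall>i\<in>{1..1::nat}.
      set (vwalk_arcs (map (cover_comp residue m n) (cycle_walk m))) = parcs (cycle_graph n)"
    by (intro exI [of _ "Suc n"]) simp
qed

text \<open>The phases at all levels determine the codes at all levels, hence the point. They attain every
compatible sequence \<open>y\<close> by compactness, since the base point moved \<open>y n\<close> steps has the right phases up
to level \<open>n\<close>.\<close>

lemma conjugate_cycle_graph:
  "conjugate X f (inverse_limit cycle_graph residue) (inverse_limit_map cycle_graph residue)"
  unfolding conjugate_def
proof (intro exI [of _ phase] conjI ballI)
  let ?Y = "inverse_limit cycle_graph residue"
  have in_lim: "phase z \<in> topspace ?Y" if "z \<in> topspace X" for z
    unfolding in_topspace_inverse_limit residue_def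
    using phase(1) [OF that] by (intro conjI allI phase_proj [OF that]) (simp add: cycle_graph_def)
  have cont_phase: "continuous_map X (discrete_topology (pverts (cycle_graph n))) (\<lambda>z. phase z n)" for n
    unfolding continuous_map_def
  proof (intro conjI allI impI)
    show "(\<lambda>z. phase z n) \<in> topspace X \<rightarrow> topspace (discrete_topology (pverts (cycle_graph n)))"
      using phase(1) by (auto simp: cycle_graph_def)
    fix U
    have "{z \<in> topspace X. phase z n \<in> U} = (\<Union>k\<in>U. {z \<in> topspace X. phase z n = k})" by auto
    then show "openin X {z \<in> topspace X. phase z n \<in> U}" using open_phase by auto
  qed
  have "continuous_map X ?Y phase"
    unfolding inverse_limit_def continuous_map_in_subtopology continuous_map_componentwise_UNIV
  proof (intro conjI allI cont_phase funcsetI CollectI)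
    fix z n assume "z \<in> topspace X"
    then show "phase z n = residue n (phase z (Suc n))" unfolding residue_def by (rule phase_proj)
  qed
  moreover have "inj_on phase (topspace X)"
  proof (rule inj_onI)
    fix x y assume xy: "x \<in> topspace X" "y \<in> topspace X" "phase x = phase y"
    have "\<pi> x n = \<pi> y n" for n
      using phase(2) [OF xy(1), of n, unfolded tracks_def, THEN spec, of 0]
        phase(2) [OF xy(2), of n, unfolded tracks_def, THEN spec, of 0] xy(3) by simp
    then show "x = y" using inj xy by blast
  qed
  moreover have "phase ` topspace X = topspace ?Y"
  proof (intro equalityI subsetI)
    fix y assume y: "y \<in> topspace ?Y"
    note y' = y [unfolded in_topspace_inverse_limit]
    have y_in: "y n \<in> pverts (cycle_graph n)" for n using y' [THEN conjunct1] by (rule spec)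
    then have y_less: "y n < per n" for n by (simp add: cycle_graph_def)
    have y_proj: "y n = y (Suc n) mod per n" for n
      using y' [THEN conjunct2, THEN spec, of n] unfolding residue_def .
    let ?F = "\<lambda>n. {z \<in> topspace X. phase z n = y n}"
    have "(\<Inter>n. ?F n) \<noteq> {}"
    proof (rule compact_space_imp_nest)
      show "compact_space X" using system by (simp add: zero_dim_system_def)
      show "closedin X (?F n)" for n
        using closedin_continuous_map_preimage [OF cont_phase, of n "{y n}"] y_in
        by simp
      have "(f ^^ y n) base \<in> ?F n" for n using y_less by (simp add: phase_base)
      then show "?F n \<noteq> {}" for n by blast
      show "decseq ?F"
      proof (rule decseq_SucI, rule subsetI)
        fix n z assume "z \<in> ?F (Suc n)"
        then show "z \<in> ?F n" using phase_proj [of z n] y_proj [of n] by simp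
      qed
    qed
    then obtain z where "z \<in> topspace X" "\<And>n. phase z n = y n" by blast
    then show "y \<in> phase ` topspace X" by (intro image_eqI [of _ _ z]) auto
  qed (use in_lim in auto)
  moreover have "Hausdorff_space ?Y"
    unfolding inverse_limit_def
    by (intro Hausdorff_space_subtopology) (simp add: Hausdorff_space_product_topology)
  ultimately show "homeomorphic_map X ?Y phase"
    using system by (intro continuous_imp_homeomorphic_map) (auto simp: zero_dim_system_def)
  fix x assume x: "x \<in> topspace X"
  have fx: "f x \<in> topspace X" using iter_in [OF x, of 1] by simp
  have "phase (f x) \<in> topspace ?Y \<and> (\<forall>i. (phase x i, phase (f x) i) \<in> parcs (cycle_graph i))"
    using in_lim [OF fx] phase_f [OF x] phase(1) [OF x] by (auto simp: cycle_graph_def)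
  then show "phase (f x) = inverse_limit_map cycle_graph residue (phase x)"
    unfolding inverse_limit_map_def
    using inverse_limit_map_well_defined [OF covering_cycle_graph in_lim [OF x]]
    by (intro the1_equality [symmetric])
qed

theorem rank_one: "GM_representable X f 1"
proof -
  have "GM_rank (\<lambda>_. 1) = 1" by (simp add: GM_rank_def Liminf_const one_enat_def)
  then show ?thesis
    unfolding GM_representable_def
    using GM_covering_cycle_graph GM_simple_cycle_graph conjugate_cycle_graph by blast
qed

end

section \<open>Expansiveness for finite rank\<close>

lemma natural_extension_orbit:
  assumes "x \<in> topspace (natural_extension X f)"
  shows "(f ^^ k) (x i) = x (i + int k)"
proof (induction k)
  case (Suc k)
  then show ?case
    using assms unfolding topspace_natural_extension by (simp add: ac_simps)
qed simp

theorem theorem6p1: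
  fixes X :: "'a topology" and f :: "'a \<Rightarrow> 'a" and K :: enat
  assumes "zero_dim_system X f" and "minimal X f"
    and "has_topological_rank X f K" and "1 < K" and "K < \<infinity>"
  shows "expansive (natural_extension X f) shift"
proof -
  let ?N = "topspace (natural_extension X f)"
  obtain k where k: "K = enat k" using assms(5) by (cases K) auto
  have "GM_representable X f K"
    using assms(3) unfolding has_topological_rank_def by blast
  then obtain G :: "nat \<Rightarrow> nat pair_pre_digraph" and \<phi> v l c
    where GM: "GM_covering G \<phi> v l c" and rank: "GM_rank l = K"
      and conj: "conjugate X f (inverse_limit G \<phi>) (inverse_limit_map G \<phi>)"
    unfolding GM_representable_def by blast
  from conj obtain h where homeo: "homeomorphic_map X (inverse_limit G \<phi>) h"
    and h_f: "\<And>x. x \<in> topspace X \<Longrightarrow> h (f x) = inverse_limit_map G \<phi> (h x)"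
    unfolding conjugate_def by blast
  have cov: "covering G \<phi>" using GM unfolding GM_covering_def by blast
  have fX: "f x \<in> topspace X" if "x \<in> topspace X" for x
    using assms(1) that unfolding zero_dim_system_def by blast
  have h_lim: "h x \<in> topspace (inverse_limit G \<phi>)" if "x \<in> topspace X" for x
    using homeomorphic_imp_surjective_map [OF homeo] that by blast
  have h_in: "h x n \<in> pverts (G n)" if "x \<in> topspace X" for x n
    using h_lim [OF that, unfolded in_topspace_inverse_limit, THEN conjunct1] by (rule spec)
  have h_proj: "h x n = \<phi> n (h x (Suc n))" if "x \<in> topspace X" for x n
    using h_lim [OF that, unfolded in_topspace_inverse_limit, THEN conjunct2] by (rule spec)
  have h_arc: "(h x n, h (f x) n) \<in> parcs (G n)" if "x \<in> topspace X" for x n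
    using theI' [OF inverse_limit_map_well_defined [OF cov h_lim [OF that]]]
    unfolding h_f [OF that] inverse_limit_map_def by blast
  have h_inj: "x = y" if "x \<in> topspace X" "y \<in> topspace X" "\<And>n. h x n = h y n" for x y
    using homeomorphic_imp_injective_map [OF homeo] that by (meson ext inj_onD)
  have h_cont: "continuous_map X (discrete_topology (pverts (G n))) (\<lambda>x. h x n)" for n
    using homeomorphic_imp_continuous_map [OF homeo]
    unfolding inverse_limit_def continuous_map_in_subtopology continuous_map_componentwise_UNIV
    by blast
  define row where "row n x i = h (x i) n" for n and x :: "int \<Rightarrow> 'a" and i
  have inX: "x i \<in> topspace X" if "x \<in> ?N" for x i
    using that unfolding topspace_natural_extension by blast
  have row_proj: "row n x = \<phi> n \<circ> row (Suc n) x" if "x \<in> ?N" for n x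
    unfolding row_def comp_def by (rule ext) (rule h_proj [OF inX [OF that]])
  have coded_below: "coded_by (row n ` ?N) k" if "coded_by (row m ` ?N) k" "n \<le> m" for m n
    using that(2,1)
  proof (induction n rule: inc_induct)
    case (step n)
    have "(\<circ>) (\<phi> n) ` row (Suc n) ` ?N = row n ` ?N"
      unfolding image_image by (intro image_cong refl) (rule row_proj [symmetric])
    then show ?case using coded_by_image [OF step.IH [OF step.prems], of "\<phi> n"] by simp
  qed
  have coded: "coded_by (row n ` ?N) k" for n
  proof -
    obtain m where m: "Suc n \<le> m" "l m \<le> k"
      using GM_rank_frequently [of l k "Suc n"] rank k by blast
    then have m0: "m > 0" by simp
    let ?Z = "(\<lambda>a. butlast (c m a)) ` {1..l m}"
    have card: "card ?Z \<le> k" using card_image_le [of "{1..l m}" "\<lambda>a. butlast (c m a)"] m(2) by simp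
    have nonempty: "[] \<notin> ?Z"
    proof
      assume "[] \<in> ?Z"
      then obtain a where a: "a \<in> {1..l m}" "butlast (c m a) = []" by auto
      then have "circuit (G m) (c m a)"
        using GM [unfolded GM_covering_def, THEN conjunct2, THEN spec, THEN mp, OF m0] by blast
      then show False
        using arg_cong [OF a(2), of length] unfolding circuit_def by simp
    qed
    have fact: "\<exists>C. factorization ?Z w C" if "w \<in> row m ` ?N" for w
    proof -
      obtain x where x: "x \<in> ?N" "w = row m x" using \<open>w \<in> row m ` ?N\<close> by blast
      have "factorization ?Z w {i. w i = v m}"
      proof (rule GM_walk_factorization [OF GM m0])
        fix i
        show "(w i, w (i + 1)) \<in> parcs (G m)"
          using h_arc [OF inX [OF x(1), of i], of m] x unfolding row_def topspace_natural_extension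
          by simp
      qed
      then show ?thesis by (rule exI)
    qed
    have "coded_by (row m ` ?N) k"
      unfolding coded_by_def using card nonempty fact
      by (intro exI [of _ ?Z] conjI ballI) simp_all
    then show ?thesis using coded_below m(1) by simp
  qed
  \<comment> \<open>Otherwise the system has rank one.\<close>
  have "\<exists>n0. \<forall>n\<ge>n0. \<forall>x\<in>?N. \<forall>d>0. \<exists>i. row n x (i + d) \<noteq> row n x i"
  proof (rule ccontr)
    assume "\<not> ?thesis"
    then have recurrent: "\<exists>n\<ge>n0. \<exists>x\<in>?N. \<exists>d>0. \<forall>i. row n x (i + d) = row n x i" for n0
      by blast
    have periodic: "\<exists>x\<in>topspace X. \<exists>d>0. \<forall>j. h ((f ^^ (j + d)) x) n = h ((f ^^ j) x) n" for n
    proof -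
      obtain m x d where m: "n \<le> m" "x \<in> ?N" "d > 0" "\<forall>i. row m x (i + d) = row m x i"
        using recurrent by blast
      have "\<forall>i. row n x (i + d) = row n x i"
        using m(1,4)
      proof (induction n rule: inc_induct)
        case (step n)
        then show ?case using row_proj [OF m(2), of n] by simp
      qed
      then have "h ((f ^^ (j + nat d)) (x 0)) n = h ((f ^^ j) (x 0)) n" for j
        using m(3) unfolding row_def by (simp add: natural_extension_orbit [OF m(2)])
      then show ?thesis
        using m(3) inX [OF m(2)] by (intro bexI [of _ "x 0"] exI [of _ "nat d"]) auto
    qed
    have "periodic_levels X f h \<phi>"
    proof
      show "zero_dim_system X f" "minimal X f" by fact+
      show "topspace X \<noteq> {}" using periodic by blast
      fix n
      show "continuous_map X (discrete_topology UNIV) (\<lambda>x. h x n)"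
        unfolding continuous_map_def
      proof (intro conjI allI impI)
        fix V :: "nat set"
        have "{x \<in> topspace X. h x n \<in> V} = {x \<in> topspace X. h x n \<in> V \<inter> pverts (G n)}"
          using h_in by blast
        then show "openin X {x \<in> topspace X. h x n \<in> V}"
          using openin_continuous_map_preimage [OF h_cont, of n "V \<inter> pverts (G n)"] by simp
      qed simp
      show "\<exists>x\<in>topspace X. \<exists>d>0. \<forall>j. h ((f ^^ (j + d)) x) n = h ((f ^^ j) x) n"
        by (rule periodic)
      show "h x n = \<phi> n (h x (Suc n))" if "x \<in> topspace X" for x
        using that by (rule h_proj)
    next
      fix x y assume xy: "x \<in> topspace X" "y \<in> topspace X"
      obtain u where "G 0 = \<lparr>pverts = {u}, parcs = {(u, u)}\<rparr>"
        using cov unfolding covering_def by blast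
      then show "h x 0 = h y 0" using h_in [OF xy(1), of 0] h_in [OF xy(2), of 0] by simp
      show "x = y" if "\<And>n. h x n = h y n" using xy that by (rule h_inj)
    qed
    then have "GM_representable X f 1" by (rule periodic_levels.rank_one)
    then have "K \<le> 1" using assms(3) unfolding has_topological_rank_def by blast
    then show False using assms(4) by simp
  qed
  then obtain n0 where aper: "\<And>n x d. n \<ge> n0 \<Longrightarrow> x \<in> ?N \<Longrightarrow> d > 0 \<Longrightarrow>
      \<exists>i. row n x (i + d) \<noteq> row n x i"
    by blast
  obtain m where m: "\<forall>x\<in>?N. \<forall>y\<in>?N. row m x = row m y \<longrightarrow> (\<forall>n. row n x = row n y)"
    using row_determines_all_rows [of ?N row \<phi> k n0, OF row_proj coded aper] by blast
  show ?thesis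
  proof (rule expansive_if_coding_injective)
    show "compact_space X" "metrizable_space X" "continuous_map X X f"
      using assms(1) by (simp_all add: zero_dim_system_def)
    show "continuous_map X (discrete_topology (pverts (G m))) (\<lambda>x. h x m)" by (rule h_cont)
    fix x y assume xy: "x \<in> ?N" "y \<in> ?N" and eq: "\<And>i. h (x i) m = h (y i) m"
    have "row m x = row m y" unfolding row_def using eq by (rule ext)
    then have "row n x i = row n y i" for n i using m xy by metis
    then have "x i = y i" for i using h_inj [OF inX [OF xy(1)] inX [OF xy(2)]] unfolding row_def by blast
    then show "x = y" by (rule ext)
  qed
qed

end
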